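(* Let $\phi:(M,g)\to (N,h)$ be a (not necessarily Riemannian) submersion between Riemannian manifolds, with $M$ non-compact. Assume that the tension field $\tau(\phi)$ is basic, i.e. $\tau(\phi)=\zeta\circ\phi$ for some vector field $\zeta$ on $N$. If $\zeta$ is a Killing vector field and $|\zeta|^2=c^2\neq 0$ is constant, then $\phi$ is proper biharmonic.
   Context: All manifolds, metrics and maps are smooth; manifolds are connected and without boundary. The tension field of $\phi$ is $\tau(\phi)=\operatorname{trace}_g\nabla d\phi$, a section of $\phi^{-1}TN$; $\phi$ is harmonic if $\tau(\phi)=0$. The bitension field is $\tau_2(\phi)=-\Delta\tau(\phi)-\operatorname{trace}R^N(d\phi,\tau(\phi))d\phi$, where $\Delta=-\operatorname{trace}\nabla^2$ is the rough Laplacian on sections of $\phi^{-1}TN$ and $R^N(X,Y)Z=[\nabla_X,\nabla_Y]Z-\nabla_{[X,Y]}Z$; that is, for a local orthonormal frame $\{e_i\}$, $\operatorname{trace}R^N(d\phi,\tau(\phi))d\phi=\sum_iR^N(d\phi(e_i),\tau(\phi))d\phi(e_i)$. The map $\phi$ is biharmonic if $\tau_2(\phi)=0$, and proper biharmonic if it is biharmonic and not harmonic. *)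

theory Defs
  imports "HOL-Analysis.Analysis"
begin

section \<open>Smooth functions on open subsets of Euclidean spaces\<close>

abbreviation fderiv :: "('m::euclidean_space \<Rightarrow> 'n::euclidean_space) \<Rightarrow> 'm \<Rightarrow> 'm \<Rightarrow> 'n" where
  "fderiv f x \<equiv> frechet_derivative f (at x)"

fun Ck_on :: "nat \<Rightarrow> 'm::euclidean_space set \<Rightarrow> ('m \<Rightarrow> 'n::euclidean_space) \<Rightarrow> bool" where
  "Ck_on 0 S f \<longleftrightarrow> continuous_on S f"
| "Ck_on (Suc k) S f \<longleftrightarrow>
     (\<forall>x\<in>S. f differentiable (at x)) \<and> (\<forall>v. Ck_on k S (\<lambda>x. fderiv f x v))"

definition smooth_on :: "'m::euclidean_space set \<Rightarrow> ('m \<Rightarrow> 'n::euclidean_space) \<Rightarrow> bool" where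
  "smooth_on S f \<longleftrightarrow> (\<forall>k. Ck_on k S f)"


section \<open>Smooth manifolds\<close>

text \<open>
  A manifold of dimension \<open>DIM('m)\<close> is modelled on the Euclidean space \<open>'m\<close>.  The atlas need
  not be maximal: it determines the smooth structure.  A chart is a total function
  \<open>chart_map\<close> of which only the values on \<open>chart_dom\<close> matter.
\<close>

record ('a, 'm) chart =
  chart_dom :: "'a set"
  chart_map :: "'a \<Rightarrow> 'm"

record ('a, 'm) manifold =
  mtop  :: "'a topology"
  atlas :: "('a, 'm) chart set"

abbreviation points :: "('a, 'm) manifold \<Rightarrow> 'a set" where
  "points M \<equiv> topspace (mtop M)"

definition chart_img :: "('a, 'm) chart \<Rightarrow> 'm set" where
  "chart_img c = chart_map c ` chart_dom c"

definition chart_inv :: "('a, 'm) chart \<Rightarrow> 'm \<Rightarrow> 'a" where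
  "chart_inv c = inv_into (chart_dom c) (chart_map c)"

definition transition :: "('a, 'm) chart \<Rightarrow> ('a, 'm) chart \<Rightarrow> 'm \<Rightarrow> 'm" where
  "transition c c' = chart_map c' \<circ> chart_inv c"

definition is_chart :: "'a topology \<Rightarrow> ('a, 'm::euclidean_space) chart \<Rightarrow> bool" where
  "is_chart X c \<longleftrightarrow> openin X (chart_dom c) \<and> open (chart_img c) \<and>
     homeomorphic_map (subtopology X (chart_dom c)) (top_of_set (chart_img c)) (chart_map c)"

definition smooth_manifold :: "('a, 'm::euclidean_space) manifold \<Rightarrow> bool" where
  "smooth_manifold M \<longleftrightarrow>
     Hausdorff_space (mtop M) \<and> second_countable (mtop M) \<and>
     connected_space (mtop M) \<and> points M \<noteq> {} \<and>
     (\<forall>c\<in>atlas M. is_chart (mtop M) c) \<and>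
     (\<Union>c\<in>atlas M. chart_dom c) = points M \<and>
     (\<forall>c\<in>atlas M. \<forall>c'\<in>atlas M.
        smooth_on (chart_map c ` (chart_dom c \<inter> chart_dom c')) (transition c c'))"

definition charts_at :: "('a, 'm) manifold \<Rightarrow> 'a \<Rightarrow> ('a, 'm) chart set" where
  "charts_at M p = {c \<in> atlas M. p \<in> chart_dom c}"

definition chart_at :: "('a, 'm) manifold \<Rightarrow> 'a \<Rightarrow> ('a, 'm) chart" where
  "chart_at M p = (SOME c. c \<in> charts_at M p)"


section \<open>Tangent vectors, maps and vector fields\<close>

text \<open>
  A tangent vector at \<open>p\<close> is the family of its component vectors with respect to all charts of
  the atlas around \<open>p\<close>, related by the derivatives of the transition maps (and extended by
  \<open>0\<close> to the remaining charts, so that equality of tangent vectors is equality of functions).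
  \<open>tangent_of M p c u\<close> is the tangent vector whose component vector in the chart \<open>c\<close> is \<open>u\<close>.
\<close>

type_synonym ('a, 'm) tangent = "('a, 'm) chart \<Rightarrow> 'm"

definition tangent_space ::
  "('a, 'm::euclidean_space) manifold \<Rightarrow> 'a \<Rightarrow> ('a, 'm) tangent set" where
  "tangent_space M p =
     {v. (\<forall>c. c \<notin> charts_at M p \<longrightarrow> v c = 0) \<and>
         (\<forall>c\<in>charts_at M p. \<forall>c'\<in>charts_at M p.
            v c' = fderiv (transition c c') (chart_map c p) (v c))}"

definition tangent_of ::
  "('a, 'm::euclidean_space) manifold \<Rightarrow> 'a \<Rightarrow> ('a, 'm) chart \<Rightarrow> 'm \<Rightarrow> ('a, 'm) tangent" where
  "tangent_of M p c u =
     (\<lambda>c'. if c' \<in> charts_at M p then fderiv (transition c c') (chart_map c p) u else 0)"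

definition zero_tangent :: "('a, 'm::zero) tangent" where
  "zero_tangent = (\<lambda>_. 0)"

definition local_map ::
  "('a, 'm) chart \<Rightarrow> ('b, 'n) chart \<Rightarrow> ('a \<Rightarrow> 'b) \<Rightarrow> 'm \<Rightarrow> 'n" where
  "local_map c d \<phi> = chart_map d \<circ> \<phi> \<circ> chart_inv c"

definition smooth_map ::
  "('a, 'm::euclidean_space) manifold \<Rightarrow> ('b, 'n::euclidean_space) manifold \<Rightarrow> ('a \<Rightarrow> 'b) \<Rightarrow> bool"
where
  "smooth_map M N \<phi> \<longleftrightarrow> continuous_map (mtop M) (mtop N) \<phi> \<and>
     (\<forall>c\<in>atlas M. \<forall>d\<in>atlas N.
        smooth_on (chart_map c ` {p \<in> chart_dom c. \<phi> p \<in> chart_dom d}) (local_map c d \<phi>))"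

text \<open>
  Here and below, objects attached to a point are computed in the charts chosen by \<open>chart_at\<close>;
  as usual, they do not depend on this choice.
\<close>

definition differential ::
  "('a, 'm::euclidean_space) manifold \<Rightarrow> ('b, 'n::euclidean_space) manifold \<Rightarrow> ('a \<Rightarrow> 'b) \<Rightarrow> 'a \<Rightarrow>
     ('a, 'm) tangent \<Rightarrow> ('b, 'n) tangent"
where
  "differential M N \<phi> p v =
     (let c = chart_at M p; d = chart_at N (\<phi> p)
      in tangent_of N (\<phi> p) d (fderiv (local_map c d \<phi>) (chart_map c p) (v c)))"

definition submersion ::
  "('a, 'm::euclidean_space) manifold \<Rightarrow> ('b, 'n::euclidean_space) manifold \<Rightarrow> ('a \<Rightarrow> 'b) \<Rightarrow> bool"
where
  "submersion M N \<phi> \<longleftrightarrow> smooth_map M N \<phi> \<and>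
     (\<forall>p\<in>points M. differential M N \<phi> p ` tangent_space M p = tangent_space N (\<phi> p))"

definition smooth_vector_field ::
  "('a, 'm::euclidean_space) manifold \<Rightarrow> ('a \<Rightarrow> ('a, 'm) tangent) \<Rightarrow> bool" where
  "smooth_vector_field M X \<longleftrightarrow>
     (\<forall>p\<in>points M. X p \<in> tangent_space M p) \<and>
     (\<forall>c\<in>atlas M. smooth_on (chart_img c) (\<lambda>x. X (chart_inv c x) c))"


section \<open>Riemannian metrics\<close>

type_synonym ('a, 'm) metric = "'a \<Rightarrow> ('a, 'm) tangent \<Rightarrow> ('a, 'm) tangent \<Rightarrow> real"

definition local_metric ::
  "('a, 'm::euclidean_space) manifold \<Rightarrow> ('a, 'm) metric \<Rightarrow> ('a, 'm) chart \<Rightarrow> 'm \<Rightarrow> 'm \<Rightarrow> 'm \<Rightarrow> real"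
where
  "local_metric M g c x u v =
     (let p = chart_inv c x in g p (tangent_of M p c u) (tangent_of M p c v))"

definition riemannian_metric ::
  "('a, 'm::euclidean_space) manifold \<Rightarrow> ('a, 'm) metric \<Rightarrow> bool" where
  "riemannian_metric M g \<longleftrightarrow>
     (\<forall>p\<in>points M.
        (\<forall>v\<in>tangent_space M p. \<forall>w\<in>tangent_space M p. g p v w = g p w v) \<and>
        (\<forall>v\<in>tangent_space M p. \<forall>w\<in>tangent_space M p. \<forall>z\<in>tangent_space M p. \<forall>a b.
           g p (\<lambda>c. a *\<^sub>R v c + b *\<^sub>R w c) z = a * g p v z + b * g p w z) \<and>
        (\<forall>v\<in>tangent_space M p. v \<noteq> zero_tangent \<longrightarrow> 0 < g p v v)) \<and>
     (\<forall>c\<in>atlas M. \<forall>u v. smooth_on (chart_img c) (\<lambda>x. local_metric M g c x u v))"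

definition riemannian_manifold ::
  "('a, 'm::euclidean_space) manifold \<Rightarrow> ('a, 'm) metric \<Rightarrow> bool" where
  "riemannian_manifold M g \<longleftrightarrow> smooth_manifold M \<and> riemannian_metric M g"


section \<open>Riemannian geometry in a chart\<close>

text \<open>
  In this section \<open>G\<close> and \<open>H\<close> are metrics on open subsets of the model spaces \<open>'m\<close> and \<open>'n\<close>,
  vector fields are functions \<open>'m \<Rightarrow> 'm\<close>, and sections of the pull-back bundle along
  \<open>f :: 'm \<Rightarrow> 'n\<close> are functions \<open>'m \<Rightarrow> 'n\<close>.

  The Levi-Civita connection is written as \<open>\<nabla>\<^sub>X Y = D\<^sub>X Y + \<Gamma>(X, Y)\<close>, where \<open>\<Gamma>\<close> is the unique
  bilinear map for which \<open>\<nabla>\<close> is torsion-free (\<open>\<Gamma>\<close> is symmetric) and compatible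
  with the metric.
\<close>

definition christoffel ::
  "('m::euclidean_space \<Rightarrow> 'm \<Rightarrow> 'm \<Rightarrow> real) \<Rightarrow> 'm \<Rightarrow> 'm \<Rightarrow> 'm \<Rightarrow> 'm" where
  "christoffel G x = (THE \<Gamma>. bilinear \<Gamma> \<and> (\<forall>u v. \<Gamma> u v = \<Gamma> v u) \<and>
     (\<forall>u v w. fderiv (\<lambda>y. G y u v) x w = G x (\<Gamma> w u) v + G x u (\<Gamma> w v)))"

definition cov ::
  "('m::euclidean_space \<Rightarrow> 'm \<Rightarrow> 'm \<Rightarrow> real) \<Rightarrow> ('m \<Rightarrow> 'm) \<Rightarrow> ('m \<Rightarrow> 'm) \<Rightarrow> 'm \<Rightarrow> 'm" where
  "cov G X Y x = fderiv Y x (X x) + christoffel G x (X x) (Y x)"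

definition lie_bracket ::
  "('m::euclidean_space \<Rightarrow> 'm) \<Rightarrow> ('m \<Rightarrow> 'm) \<Rightarrow> 'm \<Rightarrow> 'm" where
  "lie_bracket X Y x = fderiv Y x (X x) - fderiv X x (Y x)"

definition curvature_field ::
  "('m::euclidean_space \<Rightarrow> 'm \<Rightarrow> 'm \<Rightarrow> real) \<Rightarrow>
     ('m \<Rightarrow> 'm) \<Rightarrow> ('m \<Rightarrow> 'm) \<Rightarrow> ('m \<Rightarrow> 'm) \<Rightarrow> 'm \<Rightarrow> 'm"
where
  "curvature_field G X Y Z x =
     cov G X (cov G Y Z) x - cov G Y (cov G X Z) x - cov G (lie_bracket X Y) Z x"

text \<open>
  Tensors are evaluated on vectors at \<open>x\<close> by extending these to constant vector fields of the
  chart; the value of a tensor does not depend on the extension.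
\<close>

definition curvature ::
  "('m::euclidean_space \<Rightarrow> 'm \<Rightarrow> 'm \<Rightarrow> real) \<Rightarrow> 'm \<Rightarrow> 'm \<Rightarrow> 'm \<Rightarrow> 'm \<Rightarrow> 'm" where
  "curvature G x u v w = curvature_field G (\<lambda>_. u) (\<lambda>_. v) (\<lambda>_. w) x"

definition lie_derivative_metric ::
  "('m::euclidean_space \<Rightarrow> 'm \<Rightarrow> 'm \<Rightarrow> real) \<Rightarrow> ('m \<Rightarrow> 'm) \<Rightarrow> 'm \<Rightarrow> 'm \<Rightarrow> 'm \<Rightarrow> real" where
  "lie_derivative_metric G X x u v =
     fderiv (\<lambda>y. G y u v) x (X x)
       - G x (lie_bracket X (\<lambda>_. u) x) v - G x u (lie_bracket X (\<lambda>_. v) x)"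

definition orthonormal_basis ::
  "('m::euclidean_space \<Rightarrow> 'm \<Rightarrow> real) \<Rightarrow> 'm set \<Rightarrow> bool" where
  "orthonormal_basis B E \<longleftrightarrow> finite E \<and> card E = DIM('m) \<and>
     (\<forall>e\<in>E. \<forall>e'\<in>E. B e e' = (if e = e' then 1 else 0))"

definition metric_trace ::
  "('m::euclidean_space \<Rightarrow> 'm \<Rightarrow> real) \<Rightarrow> ('m \<Rightarrow> 'm \<Rightarrow> 'n::euclidean_space) \<Rightarrow> 'n" where
  "metric_trace B T = (\<Sum>e\<in>(SOME E. orthonormal_basis B E). T e e)"

text \<open>The connection on the pull-back bundle \<open>f\<^sup>-\<^sup>1TN\<close>.\<close>

definition pullback_cov ::
  "('n::euclidean_space \<Rightarrow> 'n \<Rightarrow> 'n \<Rightarrow> real) \<Rightarrow> ('m::euclidean_space \<Rightarrow> 'n) \<Rightarrow>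
     ('m \<Rightarrow> 'm) \<Rightarrow> ('m \<Rightarrow> 'n) \<Rightarrow> 'm \<Rightarrow> 'n"
where
  "pullback_cov H f X \<sigma> x =
     fderiv \<sigma> x (X x) + christoffel H (f x) (fderiv f x (X x)) (\<sigma> x)"

text \<open>\<open>(\<nabla>df)(X, Y) = \<nabla>\<^sub>X(df Y) - df(\<nabla>\<^sub>X Y)\<close>\<close>

definition second_fundamental_form ::
  "('m::euclidean_space \<Rightarrow> 'm \<Rightarrow> 'm \<Rightarrow> real) \<Rightarrow> ('n::euclidean_space \<Rightarrow> 'n \<Rightarrow> 'n \<Rightarrow> real) \<Rightarrow>
     ('m \<Rightarrow> 'n) \<Rightarrow> 'm \<Rightarrow> 'm \<Rightarrow> 'm \<Rightarrow> 'n"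
where
  "second_fundamental_form G H f x u v =
     pullback_cov H f (\<lambda>_. u) (\<lambda>y. fderiv f y v) x
       - fderiv f x (cov G (\<lambda>_. u) (\<lambda>_. v) x)"

text \<open>\<open>(\<nabla>\<^sup>2\<sigma>)(X, Y) = \<nabla>\<^sub>X(\<nabla>\<^sub>Y \<sigma>) - \<nabla>\<^bsub>\<nabla>\<^sub>X Y\<^esub> \<sigma>\<close>\<close>

definition second_cov ::
  "('m::euclidean_space \<Rightarrow> 'm \<Rightarrow> 'm \<Rightarrow> real) \<Rightarrow> ('n::euclidean_space \<Rightarrow> 'n \<Rightarrow> 'n \<Rightarrow> real) \<Rightarrow>
     ('m \<Rightarrow> 'n) \<Rightarrow> ('m \<Rightarrow> 'n) \<Rightarrow> 'm \<Rightarrow> 'm \<Rightarrow> 'm \<Rightarrow> 'n"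
where
  "second_cov G H f \<sigma> x u v =
     pullback_cov H f (\<lambda>_. u) (pullback_cov H f (\<lambda>_. v) \<sigma>) x
       - pullback_cov H f (cov G (\<lambda>_. u) (\<lambda>_. v)) \<sigma> x"

definition rough_laplacian ::
  "('m::euclidean_space \<Rightarrow> 'm \<Rightarrow> 'm \<Rightarrow> real) \<Rightarrow> ('n::euclidean_space \<Rightarrow> 'n \<Rightarrow> 'n \<Rightarrow> real) \<Rightarrow>
     ('m \<Rightarrow> 'n) \<Rightarrow> ('m \<Rightarrow> 'n) \<Rightarrow> 'm \<Rightarrow> 'n"
where
  "rough_laplacian G H f \<sigma> x = - metric_trace (G x) (second_cov G H f \<sigma> x)"

definition local_tension ::
  "('m::euclidean_space \<Rightarrow> 'm \<Rightarrow> 'm \<Rightarrow> real) \<Rightarrow> ('n::euclidean_space \<Rightarrow> 'n \<Rightarrow> 'n \<Rightarrow> real) \<Rightarrow>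
     ('m \<Rightarrow> 'n) \<Rightarrow> 'm \<Rightarrow> 'n"
where
  "local_tension G H f x = metric_trace (G x) (second_fundamental_form G H f x)"

text \<open>The bitension field of \<open>f\<close>, where \<open>\<tau>\<close> is the tension field of \<open>f\<close>.\<close>

definition local_bitension ::
  "('m::euclidean_space \<Rightarrow> 'm \<Rightarrow> 'm \<Rightarrow> real) \<Rightarrow> ('n::euclidean_space \<Rightarrow> 'n \<Rightarrow> 'n \<Rightarrow> real) \<Rightarrow>
     ('m \<Rightarrow> 'n) \<Rightarrow> ('m \<Rightarrow> 'n) \<Rightarrow> 'm \<Rightarrow> 'n"
where
  "local_bitension G H f \<tau> x =
     - rough_laplacian G H f \<tau> x
     - metric_trace (G x) (\<lambda>u v. curvature H (f x) (fderiv f x u) (\<tau> x) (fderiv f x v))"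


section \<open>Killing fields, harmonic and biharmonic maps\<close>

definition killing_field ::
  "('a, 'm::euclidean_space) manifold \<Rightarrow> ('a, 'm) metric \<Rightarrow> ('a \<Rightarrow> ('a, 'm) tangent) \<Rightarrow> bool" where
  "killing_field M g X \<longleftrightarrow> smooth_vector_field M X \<and>
     (\<forall>c\<in>atlas M. \<forall>x\<in>chart_img c. \<forall>u v.
        lie_derivative_metric (local_metric M g c) (\<lambda>y. X (chart_inv c y) c) x u v = 0)"

definition tension ::
  "('a, 'm::euclidean_space) manifold \<Rightarrow> ('a, 'm) metric \<Rightarrow>
   ('b, 'n::euclidean_space) manifold \<Rightarrow> ('b, 'n) metric \<Rightarrow> ('a \<Rightarrow> 'b) \<Rightarrow> 'a \<Rightarrow> ('b, 'n) tangent"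
where
  "tension M g N h \<phi> p =
     (let c = chart_at M p; d = chart_at N (\<phi> p)
      in tangent_of N (\<phi> p) d
           (local_tension (local_metric M g c) (local_metric N h d) (local_map c d \<phi>)
              (chart_map c p)))"

definition bitension ::
  "('a, 'm::euclidean_space) manifold \<Rightarrow> ('a, 'm) metric \<Rightarrow>
   ('b, 'n::euclidean_space) manifold \<Rightarrow> ('b, 'n) metric \<Rightarrow> ('a \<Rightarrow> 'b) \<Rightarrow> 'a \<Rightarrow> ('b, 'n) tangent"
where
  "bitension M g N h \<phi> p =
     (let c = chart_at M p; d = chart_at N (\<phi> p)
      in tangent_of N (\<phi> p) d
           (local_bitension (local_metric M g c) (local_metric N h d) (local_map c d \<phi>)
              (\<lambda>x. tension M g N h \<phi> (chart_inv c x) d) (chart_map c p)))"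

definition harmonic ::
  "('a, 'm::euclidean_space) manifold \<Rightarrow> ('a, 'm) metric \<Rightarrow>
   ('b, 'n::euclidean_space) manifold \<Rightarrow> ('b, 'n) metric \<Rightarrow> ('a \<Rightarrow> 'b) \<Rightarrow> bool"
where
  "harmonic M g N h \<phi> \<longleftrightarrow> smooth_map M N \<phi> \<and>
     (\<forall>p\<in>points M. tension M g N h \<phi> p = zero_tangent)"

definition biharmonic ::
  "('a, 'm::euclidean_space) manifold \<Rightarrow> ('a, 'm) metric \<Rightarrow>
   ('b, 'n::euclidean_space) manifold \<Rightarrow> ('b, 'n) metric \<Rightarrow> ('a \<Rightarrow> 'b) \<Rightarrow> bool"
where
  "biharmonic M g N h \<phi> \<longleftrightarrow> smooth_map M N \<phi> \<and>
     (\<forall>p\<in>points M. bitension M g N h \<phi> p = zero_tangent)"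

definition proper_biharmonic ::
  "('a, 'm::euclidean_space) manifold \<Rightarrow> ('a, 'm) metric \<Rightarrow>
   ('b, 'n::euclidean_space) manifold \<Rightarrow> ('b, 'n) metric \<Rightarrow> ('a \<Rightarrow> 'b) \<Rightarrow> bool"
where
  "proper_biharmonic M g N h \<phi> \<longleftrightarrow> biharmonic M g N h \<phi> \<and> \<not> harmonic M g N h \<phi>"

end

theory Submission
  imports Defs
begin

text \<open>
  Write \<open>AX = \<nabla>\<^sub>X \<zeta>\<close>.  Since \<open>\<tau>(\<phi>) = \<zeta> \<circ> \<phi>\<close>, the chain rule gives
  \<open>\<nabla>\<^sup>2\<tau>(u, v) = A(\<nabla>d\<phi>(u, v)) + (\<nabla>\<^sup>2\<zeta>)(d\<phi> u, d\<phi> v)\<close>.  A Killing field satisfies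
  \<open>(\<nabla>\<^sup>2\<zeta>)(X, Y) = R(X, \<zeta>)Y\<close>, so after taking traces the curvature terms of \<open>\<tau>\<^sub>2(\<phi>)\<close> cancel
  and \<open>\<tau>\<^sub>2(\<phi>) = A(\<tau>(\<phi>)) = \<nabla>\<^sub>\<zeta> \<zeta>\<close> along \<open>\<phi>\<close>.  This vanishes because \<open>A\<close> is skew and
  \<open>|\<zeta>|\<^sup>2\<close> is constant: \<open>h(\<nabla>\<^sub>\<zeta> \<zeta>, X) = -h(\<zeta>, \<nabla>\<^sub>X \<zeta>) = 0\<close>.
\<close>

section \<open>Second derivatives and families of linear maps\<close>

text \<open>\<open>tension\<close> and \<open>bitension\<close> are computed in the charts chosen at
  \<open>p\<close> and \<open>\<phi> p\<close>, so the whole argument can run between open subsets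
  of Euclidean spaces, for that single pair of charts. The obstacle is regularity. Smoothness is
  given through derivatives along fixed vectors, so the product and chain rules must be applied to
  families of linear maps known to be differentiable only one vector at a time. Moreover
  \<open>christoffel\<close> is a definite description: its existence, uniqueness and
  differentiability have to be established before curvature can be expanded. The Koszul formula
  supplies all three, since it presents \<open>\<Gamma>\<close> as the solution of a linear system
  whose data are the metric and its first derivatives.\<close>

lemma smooth_on_differentiable:
  "smooth_on S f \<Longrightarrow> x \<in> S \<Longrightarrow> f differentiable (at x)"
  unfolding smooth_on_def by (metis Ck_on.simps(2))

lemma smooth_on_fderiv:
  "smooth_on S f \<Longrightarrow> smooth_on S (\<lambda>x. fderiv f x v)"
  unfolding smooth_on_def by (metis Ck_on.simps(2))

lemma fderiv_eqI: "(f has_derivative f') (at x) \<Longrightarrow> fderiv f x = f'"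
  by (metis frechet_derivative_at)

lemma has_derivative_fderiv:
  "f differentiable (at x) \<Longrightarrow> (f has_derivative fderiv f x) (at x)"
  by (simp add: frechet_derivative_works)

text \<open>\<open>frechet_derivative\<close> selects one of the derivatives of a function. Two
  functions that agree near \<open>x\<close> have the same derivatives there, so the selections
  agree even where neither is differentiable.\<close>

lemma fderiv_cong_open:
  assumes "open S" "x \<in> S" "\<And>y. y \<in> S \<Longrightarrow> f y = g y"
  shows "fderiv f x = fderiv g x"
proof -
  have "(f has_derivative D) (at x) \<longleftrightarrow> (g has_derivative D) (at x)" for D
    using has_derivative_transform_within_open assms by (metis (no_types, lifting))
  then show ?thesis unfolding frechet_derivative_def by simp
qed

section \<open>Product rules for families of linear and bilinear maps\<close>

lemma linear_sum_Basis:
  fixes F :: "'a::euclidean_space \<Rightarrow> 'b::real_vector"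
  assumes "linear F"
  shows "F v = (\<Sum>b\<in>Basis. (v \<bullet> b) *\<^sub>R F b)"
  by (metis (no_types, lifting) assms euclidean_representation linear_cmul linear_sum sum.cong)

text \<open>Expanding \<open>w y\<close> in the standard basis turns \<open>F y (w y)\<close> into a
  finite sum of scalar functions times the maps \<open>\<lambda>y. F y b\<close>, to which the
  ordinary product rule applies.\<close>

lemma has_derivative_linear_family:
  fixes F :: "'a::euclidean_space \<Rightarrow> 'b::euclidean_space \<Rightarrow> 'c::euclidean_space"
  assumes S: "open S" "x \<in> S" and lin: "\<And>y. y \<in> S \<Longrightarrow> linear (F y)"
    and F: "\<And>v. (\<lambda>y. F y v) differentiable (at x)"
    and w: "(w has_derivative w') (at x)"
  shows "((\<lambda>y. F y (w y)) has_derivative (\<lambda>u. fderiv (\<lambda>y. F y (w x)) x u + F x (w' u))) (at x)"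
proof -
  define F' where "F' v = fderiv (\<lambda>y. F y v) x" for v
  have F': "((\<lambda>y. F y v) has_derivative F' v) (at x)" for v
    unfolding F'_def by (rule has_derivative_fderiv[OF F])
  have gen: "((\<lambda>y. F y (w y))
      has_derivative (\<lambda>u. (\<Sum>b\<in>Basis. (w x \<bullet> b) *\<^sub>R F' b u) + F x (w' u))) (at x)"
    if w: "(w has_derivative w') (at x)" for w w'
  proof -
    have "((\<lambda>y. \<Sum>b\<in>Basis. (w y \<bullet> b) *\<^sub>R F y b) has_derivative
      (\<lambda>u. \<Sum>b\<in>Basis. (w x \<bullet> b) *\<^sub>R F' b u + (w' u \<bullet> b) *\<^sub>R F x b)) (at x)"
      by (auto intro!: derivative_eq_intros w F')
    moreover have "(\<Sum>b\<in>Basis. (w x \<bullet> b) *\<^sub>R F' b u + (w' u \<bullet> b) *\<^sub>R F x b)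
        = (\<Sum>b\<in>Basis. (w x \<bullet> b) *\<^sub>R F' b u) + F x (w' u)" for u
      by (simp add: sum.distrib linear_sum_Basis[OF lin[OF S(2)], symmetric])
    ultimately have "((\<lambda>y. \<Sum>b\<in>Basis. (w y \<bullet> b) *\<^sub>R F y b) has_derivative
      (\<lambda>u. (\<Sum>b\<in>Basis. (w x \<bullet> b) *\<^sub>R F' b u) + F x (w' u))) (at x)" by simp
    then show ?thesis
      by (rule has_derivative_transform_within_open[OF _ S])
        (simp add: linear_sum_Basis[OF lin, symmetric])
  qed
  have "((\<lambda>y. F y (w x)) has_derivative (\<lambda>u. \<Sum>b\<in>Basis. (w x \<bullet> b) *\<^sub>R F' b u)) (at x)"
    using gen[of "\<lambda>_. w x" "\<lambda>_. 0"] linear_0[OF lin[OF S(2)]] by simp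
  from has_derivative_unique[OF this F'[of "w x"]]
  have "(\<Sum>b\<in>Basis. (w x \<bullet> b) *\<^sub>R F' b u) = F' (w x) u" for u
    by (rule fun_cong)
  then show ?thesis
    using gen[OF w] unfolding F'_def by simp
qed

lemma has_derivative_bilinear_family:
  fixes F :: "'a::euclidean_space \<Rightarrow> 'b::euclidean_space \<Rightarrow> 'd::euclidean_space \<Rightarrow> 'c::euclidean_space"
  assumes S: "open S" "x \<in> S" and lin: "\<And>y. y \<in> S \<Longrightarrow> bilinear (F y)"
    and F: "\<And>v w. (\<lambda>y. F y v w) differentiable (at x)"
    and v: "(v has_derivative v') (at x)"
    and w: "(w has_derivative w') (at x)"
  shows "((\<lambda>y. F y (v y) (w y)) has_derivative
    (\<lambda>u. fderiv (\<lambda>y. F y (v x) (w x)) x u + F x (v' u) (w x) + F x (v x) (w' u))) (at x)"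
proof -
  have *: "((\<lambda>y. F y v (w y)) has_derivative
    (\<lambda>u. fderiv (\<lambda>y. F y v (w x)) x u + F x v (w' u))) (at x)" for v
    by (rule has_derivative_linear_family[OF S _ _ w])
       (use lin F in \<open>auto simp: bilinear_def\<close>)
  then have **: "(\<lambda>y. F y v (w y)) differentiable (at x)" for v
    unfolding differentiable_def by blast
  have "((\<lambda>y. F y (v y) (w y)) has_derivative
    (\<lambda>u. fderiv (\<lambda>y. F y (v x) (w y)) x u + F x (v' u) (w x))) (at x)"
    by (rule has_derivative_linear_family[OF S _ _ v, where F = "\<lambda>y v. F y v (w y)"])
       (use lin ** in \<open>auto simp: bilinear_def\<close>)
  then show ?thesis by (simp add: fderiv_eqI[OF *] algebra_simps)
qed

lemma fderiv_linear_compose: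
  assumes "linear L" "f differentiable (at x)"
  shows "fderiv (\<lambda>y. L (f y)) x u = L (fderiv f x u)"
proof -
  have "((\<lambda>y. L (f y)) has_derivative (\<lambda>u. L (fderiv f x u))) (at x)"
    by (rule bounded_linear.has_derivative[OF _ has_derivative_fderiv])
       (use assms in \<open>auto simp: linear_conv_bounded_linear\<close>)
  then show ?thesis by (simp add: fderiv_eqI)
qed

section \<open>Symmetry of second derivatives\<close>

text \<open>The second difference is the increment of a one-variable function along
  \<open>v\<close>. The mean value theorem turns it into a difference of two values of the
  derivative along \<open>v\<close>, and differentiability of that derivative at the single point
  \<open>x\<close> gives the limit.\<close>

lemma second_difference_tendsto:
  fixes f :: "'a::euclidean_space \<Rightarrow> real"
  assumes S: "open S" "x \<in> S" and f: "\<And>y. y \<in> S \<Longrightarrow> f differentiable (at y)"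
    and f': "(\<lambda>y. fderiv f y v) differentiable (at x)"
  shows "((\<lambda>t. (f (x + t *\<^sub>R u + t *\<^sub>R v) - f (x + t *\<^sub>R u) - f (x + t *\<^sub>R v) + f x) / t\<^sup>2)
     \<longlongrightarrow> fderiv (\<lambda>y. fderiv f y v) x u) (at_right 0)"
    (is "(?\<Delta> \<longlongrightarrow> _) _")
proof (rule tendstoI)
  fix e :: real assume e: "e > 0"
  define g where "g y = fderiv f y v" for y
  define D where "D = fderiv g x"
  have D: "(g has_derivative D) (at x)"
    unfolding D_def g_def by (rule has_derivative_fderiv[OF f'])
  have Dlin: "linear D" using D has_derivative_linear by blast
  define K where "K = norm u + norm v + 1"
  \<comment> \<open>Two first-order remainders, each at most \<open>\<epsilon> * (t * K)\<close>,
    are divided by \<open>t\<close>; the total is at most \<open>2 * \<epsilon> * K = e / 2\<close>.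
    The summand 1 in \<open>K\<close> keeps it positive when \<open>u\<close> and \<open>v\<close>
    vanish.\<close>
  define \<epsilon> where "\<epsilon> = e / (4 * K)"
  have K: "K > 0" "norm u \<le> K" "norm v \<le> K" "norm u + norm v \<le> K"
    by (auto simp: K_def add_nonneg_pos)
  have \<epsilon>: "\<epsilon> > 0" using e K by (simp add: \<epsilon>_def)
  obtain d where d: "d > 0" "\<And>y. norm (y - x) < d \<Longrightarrow> norm (g y - g x - D (y - x)) \<le> \<epsilon> * norm (y - x)"
    using D \<epsilon> unfolding has_derivative_at_alt by blast
  obtain r where r: "r > 0" "ball x r \<subseteq> S" using S open_contains_ball by blast
  define t0 where "t0 = min d r / K"
  have t0: "t0 > 0" using d r K by (simp add: t0_def)
  have "dist (?\<Delta> t) (D u) < e" if t: "0 < t" "t < t0" for t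
  proof -
    have alg: "X - d = ((a - c - a') - (b - c - b')) / t"
      if "X = (a - b) / t" "d = (a' - b') / t" for X d a b c a' b' :: real
      using that by (simp add: diff_divide_distrib add_divide_distrib)
    have bd: "\<bar>X\<bar> \<le> c / t" if "X = Y / t" "\<bar>Y\<bar> \<le> c" for X Y c :: real
      using that t divide_right_mono[of "\<bar>Y\<bar>" c t] by (simp add: abs_divide)
    have tK: "t * K < d" "t * K < r"
      using t K by (auto simp: t0_def field_simps)
    have small: "norm (t *\<^sub>R (a *\<^sub>R u + s *\<^sub>R v)) \<le> t * K" if "0 \<le> s" "s \<le> 1" "0 \<le> a" "a \<le> 1"
        for s a
    proof -
      have "norm (a *\<^sub>R u + s *\<^sub>R v) \<le> a * norm u + s * norm v"
        using norm_triangle_ineq[of "a *\<^sub>R u" "s *\<^sub>R v"] that by simp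
      also have "\<dots> \<le> 1 * norm u + 1 * norm v" using that by (intro add_mono mult_right_mono) auto
      also have "\<dots> \<le> K" using K by simp
      finally show ?thesis using t by (simp add: mult_left_mono)
    qed
    have der: "((\<lambda>s. f (x + t *\<^sub>R (a *\<^sub>R u + s *\<^sub>R v)))
        has_derivative (\<lambda>h. h * (t * g (x + t *\<^sub>R (a *\<^sub>R u + s *\<^sub>R v))))) (at s)"
      if "0 \<le> s" "s \<le> 1" "0 \<le> a" "a \<le> 1" for s a
    proof -
      let ?y = "x + t *\<^sub>R (a *\<^sub>R u + s *\<^sub>R v)"
      have "?y \<in> S" using small[OF that] tK r by (auto simp: dist_norm subset_iff)
      then have "(f has_derivative fderiv f ?y) (at ?y)" using f has_derivative_fderiv by blast
      then have "((\<lambda>s. f (x + t *\<^sub>R (a *\<^sub>R u + s *\<^sub>R v))) has_derivative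
            (\<lambda>h. fderiv f ?y (t *\<^sub>R (h *\<^sub>R v)))) (at s)"
        by (intro has_derivative_compose[where g = f and f = "\<lambda>s. x + t *\<^sub>R (a *\<^sub>R u + s *\<^sub>R v)"
            and s = UNIV])
           (auto intro!: derivative_eq_intros)
      moreover have "linear (fderiv f ?y)" using f \<open>?y \<in> S\<close> linear_frechet_derivative by blast
      ultimately show ?thesis by (simp add: linear_cmul g_def mult_ac)
    qed
    \<comment> \<open>\<open>p s\<close> compares two parallel segments in direction
      \<open>v\<close>, one shifted by \<open>t *\<^sub>R u\<close>, so \<open>p 1 - p 0\<close> is
      the second difference. The coefficients 1 and 0 of \<open>u\<close> are the two instances of
      \<open>a\<close> in \<open>der\<close>.\<close>
    define p where "p s = f (x + t *\<^sub>R (1 *\<^sub>R u + s *\<^sub>R v)) - f (x + t *\<^sub>R (0 *\<^sub>R u + s *\<^sub>R v))"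
        for s
    have "\<exists>s\<in>{0<..<1::real}. p 1 - p 0 =
        (\<lambda>h. h * (t * g (x + t *\<^sub>R (1 *\<^sub>R u + s *\<^sub>R v)))
            - h * (t * g (x + t *\<^sub>R (0 *\<^sub>R u + s *\<^sub>R v)))) (1 - 0)"
      unfolding p_def
      by (rule mvt_simple)
        (auto intro!: has_derivative_diff has_derivative_at_withinI[OF der[where a=1, simplified]]
            has_derivative_at_withinI[OF der[where a=0, simplified]])
    then obtain s where s: "0 < s" "s < 1"
      and "p 1 - p 0 = t * g (x + t *\<^sub>R (u + s *\<^sub>R v)) - t * g (x + t *\<^sub>R (s *\<^sub>R v))"
      by auto
    moreover have "?\<Delta> t = (p 1 - p 0) / t\<^sup>2"
      by (simp add: p_def scaleR_add_right add.assoc)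
    ultimately have "?\<Delta> t = (g (x + t *\<^sub>R (u + s *\<^sub>R v)) - g (x + t *\<^sub>R (s *\<^sub>R v))) / t"
      using t by (simp add: power2_eq_square flip: right_diff_distrib)
    moreover have "D u = (D (t *\<^sub>R (u + s *\<^sub>R v)) - D (t *\<^sub>R (s *\<^sub>R v))) / t"
      using t by (simp add: Dlin linear_cmul linear_add field_simps)
    ultimately have "?\<Delta> t - D u = ((g (x + t *\<^sub>R (u + s *\<^sub>R v)) - g x - D (t *\<^sub>R (u + s *\<^sub>R v)))
        - (g (x + t *\<^sub>R (s *\<^sub>R v)) - g x - D (t *\<^sub>R (s *\<^sub>R v)))) / t"
      by (rule alg)
    moreover have "\<bar>g (x + t *\<^sub>R (a *\<^sub>R u + s *\<^sub>R v)) - g x - D (t *\<^sub>R (a *\<^sub>R u + s *\<^sub>R v))\<bar>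
        \<le> \<epsilon> * (t * K)"
      if "0 \<le> a" "a \<le> 1" for a
    proof -
      have "norm (t *\<^sub>R (a *\<^sub>R u + s *\<^sub>R v)) \<le> t * K" using small s that by simp
      then show ?thesis
        using d(2)[of "x + t *\<^sub>R (a *\<^sub>R u + s *\<^sub>R v)"] tK \<epsilon>
        by (smt (verit, ccfv_SIG) add_diff_cancel_left' mult_left_mono real_norm_def)
    qed
    from this[of 1] this[of 0]
    have "\<bar>(g (x + t *\<^sub>R (u + s *\<^sub>R v)) - g x - D (t *\<^sub>R (u + s *\<^sub>R v)))
        - (g (x + t *\<^sub>R (s *\<^sub>R v)) - g x - D (t *\<^sub>R (s *\<^sub>R v)))\<bar> \<le> 2 * (\<epsilon> * (t * K))"
      by simp
    ultimately have "\<bar>?\<Delta> t - D u\<bar> \<le> 2 * (\<epsilon> * (t * K)) / t"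
      by (rule bd)
    also have "\<dots> < e" using t e K by (simp add: \<epsilon>_def field_simps)
    finally show ?thesis by (simp add: dist_real_def)
  qed
  then show "\<forall>\<^sub>F t in at_right 0. dist (?\<Delta> t) (fderiv (\<lambda>y. fderiv f y v) x u) < e"
    unfolding D_def g_def eventually_at_right_field using t0 by blast
qed

text \<open>The second difference does not change when \<open>u\<close> and \<open>v\<close> are
  exchanged, and both iterated derivatives are limits of it. Passing to components makes the mean
  value theorem available.\<close>

lemma second_derivative_symmetric:
  fixes f :: "'a::euclidean_space \<Rightarrow> 'b::euclidean_space"
  assumes S: "open S" "x \<in> S" and f: "\<And>y. y \<in> S \<Longrightarrow> f differentiable (at y)"
    and f': "\<And>v. (\<lambda>y. fderiv f y v) differentiable (at x)"
  shows "fderiv (\<lambda>y. fderiv f y v) x u = fderiv (\<lambda>y. fderiv f y u) x v"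
proof (rule euclidean_eqI)
  fix b :: 'b assume "b \<in> Basis"
  let ?f = "\<lambda>y. f y \<bullet> b"
  have lin: "linear (\<lambda>z. z \<bullet> b)" by (simp add: bounded_linear.linear bounded_linear_inner_left)
  have fd: "?f differentiable (at y)" if "y \<in> S" for y
    using f[OF that] by simp
  have eq: "fderiv ?f y w = fderiv f y w \<bullet> b" if "y \<in> S" for y w
    using fderiv_linear_compose[OF lin f[OF that]] .
  have d2: "(\<lambda>y. fderiv ?f y w) differentiable (at x)"
    "fderiv (\<lambda>y. fderiv ?f y w) x z = fderiv (\<lambda>y. fderiv f y w) x z \<bullet> b" for w z
  proof -
    have "((\<lambda>y. fderiv f y w \<bullet> b) has_derivative (\<lambda>z. fderiv (\<lambda>y. fderiv f y w) x z \<bullet> b)) (at x)"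
      by (intro has_derivative_inner_left has_derivative_fderiv f')
    then have "((\<lambda>y. fderiv ?f y w) has_derivative (\<lambda>z. fderiv (\<lambda>y. fderiv f y w) x z \<bullet> b)) (at x)"
      by (rule has_derivative_transform_within_open[OF _ S]) (simp add: eq)
    then show "(\<lambda>y. fderiv ?f y w) differentiable (at x)"
     "fderiv (\<lambda>y. fderiv ?f y w) x z = fderiv (\<lambda>y. fderiv f y w) x z \<bullet> b"
      by (auto simp: differentiable_def fderiv_eqI)
  qed
  have "fderiv (\<lambda>y. fderiv ?f y v) x u = fderiv (\<lambda>y. fderiv ?f y u) x v"
  proof (rule tendsto_unique)
    show "((\<lambda>t. (?f (x + t *\<^sub>R u + t *\<^sub>R v) - ?f (x + t *\<^sub>R u) - ?f (x + t *\<^sub>R v) + ?f x) / t\<^sup>2)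
     \<longlongrightarrow> fderiv (\<lambda>y. fderiv ?f y v) x u) (at_right 0)"
      by (rule second_difference_tendsto[OF S fd d2(1)])
    show "((\<lambda>t. (?f (x + t *\<^sub>R u + t *\<^sub>R v) - ?f (x + t *\<^sub>R u) - ?f (x + t *\<^sub>R v) + ?f x) / t\<^sup>2)
     \<longlongrightarrow> fderiv (\<lambda>y. fderiv ?f y u) x v) (at_right 0)"
      using second_difference_tendsto[OF S fd d2(1), where u=v and v=u]
      by (simp add: algebra_simps)
  qed simp
  then show "fderiv (\<lambda>y. fderiv f y v) x u \<bullet> b = fderiv (\<lambda>y. fderiv f y u) x v \<bullet> b"
    by (simp add: d2)
qed

section \<open>Differentiability of solutions of linear systems\<close>

text \<open>From \<open>L\<^sub>x (z\<^sub>y - z\<^sub>x) = (k\<^sub>y - L\<^sub>y z\<^sub>x) - (L\<^sub>y - L\<^sub>x) (z\<^sub>y - z\<^sub>x)\<close>, the last term is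
  absorbed by the left-hand side and \<open>z\<^sub>y - z\<^sub>x\<close> agrees to first order with
  \<open>L\<^sub>x\<^sup>-\<^sup>1 (k\<^sub>y - L\<^sub>y z\<^sub>x)\<close>.\<close>

lemma linear_solution_differentiable:
  fixes L :: "'a::euclidean_space \<Rightarrow> 'b::euclidean_space \<Rightarrow> 'b"
  assumes S: "open S" "x \<in> S" and lin: "\<And>y. y \<in> S \<Longrightarrow> linear (L y)"
    and inj: "inj (L x)"
    and L: "\<And>v. (\<lambda>y. L y v) differentiable (at x)"
    and k: "k differentiable (at x)"
    and z: "\<And>y. y \<in> S \<Longrightarrow> L y (z y) = k y"
  shows "z differentiable (at x)"
proof -
  obtain K where K: "linear K" "\<And>v. K (L x v) = v"
    using linear_injective_left_inverse[OF lin[OF S(2)] inj] by (metis comp_apply id_apply)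
  have bK: "bounded_linear K" using K linear_conv_bounded_linear by blast
  define e where "e y = K (k y - L y (z x))" for y
  obtain e' where e': "(e has_derivative e') (at x)"
  proof -
    have "(\<lambda>y. k y - L y (z x)) differentiable (at x)" using k L by simp
    then have "e differentiable (at x)" unfolding e_def differentiable_def
      using bounded_linear.has_derivative[OF bK] by blast
    then show thesis using that differentiable_def by blast
  qed
  have ex: "e x = 0" using z[OF S(2)] K(1) by (simp add: e_def linear_0)
  define P where "P y v = K (L y v - L x v)" for y v
  have Plin: "linear (P y)" if "y \<in> S" for y
    unfolding P_def using linear_compose[OF linear_compose_sub[OF lin[OF that] lin[OF S(2)]] K(1)]
    by (simp add: o_def)
  \<comment> \<open>This dominates the operator norm of \<open>P y\<close>, so \<open>P y\<close> is
    small uniformly in its argument. That matters because \<open>z\<close> is not yet known to be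
    continuous.\<close>
  define \<epsilon> where "\<epsilon> y = (\<Sum>b\<in>Basis. norm (P y b))" for y
  have Pb: "norm (P y v) \<le> \<epsilon> y * norm v" if "y \<in> S" for y v
  proof -
    have "norm (P y v) \<le> (\<Sum>b\<in>Basis. norm ((v \<bullet> b) *\<^sub>R P y b))"
      by (subst linear_sum_Basis[OF Plin[OF that]]) (rule norm_sum)
    also have "\<dots> \<le> (\<Sum>b\<in>Basis. norm v * norm (P y b))"
      by (rule sum_mono) (auto simp: Basis_le_norm mult_right_mono)
    finally show ?thesis by (simp add: \<epsilon>_def sum_distrib_left mult.commute)
  qed
  have \<epsilon>0: "(\<epsilon> \<longlongrightarrow> 0) (at x)"
  proof -
    have "((\<lambda>y. P y b) \<longlongrightarrow> K 0) (at x)" for b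
    proof -
      have "isCont (\<lambda>y. L y b) x" using L differentiable_imp_continuous_within by blast
      then have "((\<lambda>y. L y b - L x b) \<longlongrightarrow> 0) (at x)"
        by (simp add: isCont_def LIM_zero_iff)
      then show ?thesis unfolding P_def by (rule bounded_linear.tendsto[OF bK])
    qed
    then have "((\<lambda>y. norm (P y b)) \<longlongrightarrow> 0) (at x)" for b
      using K(1) by (simp add: linear_0 tendsto_norm_zero)
    then have "((\<lambda>y. \<Sum>b\<in>(Basis::'b set). norm (P y b)) \<longlongrightarrow> (\<Sum>b\<in>(Basis::'b set). 0)) (at x)"
      by (intro tendsto_sum)
    then show ?thesis by (simp add: \<epsilon>_def[abs_def])
  qed
  have id: "z y - z x = e y - P y (z y - z x)" if "y \<in> S" for y
  proof -
    have "L x (z y - z x) = (k y - L y (z x)) - (L y (z y - z x) - L x (z y - z x))"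
      using z[OF that] lin[OF that] by (simp add: linear_diff)
    then have "K (L x (z y - z x)) = e y - P y (z y - z x)"
      using K(1) by (simp add: e_def P_def linear_diff)
    then show ?thesis by (simp add: K)
  qed
  \<comment> \<open>With \<open>\<epsilon> y < 1/2\<close> the perturbation is at most half of
    \<open>norm (z y - z x)\<close>, which is therefore bounded by \<open>2 * norm (e y)\<close>.
    The error then becomes a vanishing factor times a term of first order.\<close>
  have bnd: "norm ((z y - z x) - e y) \<le> 2 * \<epsilon> y * norm (e y)" if "y \<in> S" "\<epsilon> y < 1/2" for y
  proof -
    have \<epsilon>p: "\<epsilon> y \<ge> 0" by (simp add: \<epsilon>_def sum_nonneg)
    have 1: "norm ((z y - z x) - e y) \<le> \<epsilon> y * norm (z y - z x)"
      using id[OF that(1)] Pb[OF that(1), of "z y - z x"]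
      by (metis add_diff_cancel_left' diff_add_cancel minus_diff_eq norm_minus_cancel)
    have "\<epsilon> y * norm (z y - z x) \<le> 1/2 * norm (z y - z x)"
      using that by (intro mult_right_mono) auto
    then have "norm (z y - z x) \<le> 2 * norm (e y)"
      using 1 norm_triangle_ineq2[of "z y - z x" "e y"] by linarith
    then have "\<epsilon> y * norm (z y - z x) \<le> \<epsilon> y * (2 * norm (e y))"
      using \<epsilon>p by (rule mult_left_mono)
    then show ?thesis using 1 by linarith
  qed
  have lim_e: "((\<lambda>y. norm (e y - e x - e' (y - x)) / norm (y - x)) \<longlongrightarrow> 0) (at x)"
    using e' by (simp add: has_derivative_iff_norm)
  obtain C where C: "\<And>h. norm (e' h) \<le> C * norm h"
    using has_derivative_bounded_linear[OF e'] bounded_linear.bounded by (metis mult.commute)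
  have "((\<lambda>y. norm (z y - z x - e' (y - x)) / norm (y - x)) \<longlongrightarrow> 0) (at x)"
  proof (rule Lim_null_comparison)
    let ?q = "\<lambda>y. norm (e y - e x - e' (y - x)) / norm (y - x)"
    show "((\<lambda>y. 2 * \<epsilon> y * (?q y + C) + ?q y) \<longlongrightarrow> 0) (at x)"
      by (rule tendsto_eq_intros \<epsilon>0 lim_e | simp)+
    have ev: "\<forall>\<^sub>F y in at x. \<epsilon> y < 1/2" using order_tendstoD(2)[OF \<epsilon>0, of "1/2"] by simp
    have evS: "\<forall>\<^sub>F y in at x. y \<in> S" using S by (rule eventually_at_in_open')
    have evn: "\<forall>\<^sub>F y in at x. y \<noteq> x" by (rule eventually_neq_at_within)
    show "\<forall>\<^sub>F y in at x. norm (norm (z y - z x - e' (y - x)) / norm (y - x)) \<le> 2 * \<epsilon> y * (?q y + C) + ?q y"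
      using ev evS evn
    proof eventually_elim
      case (elim y)
      have n: "norm (y - x) > 0" using elim by simp
      have \<epsilon>p: "\<epsilon> y \<ge> 0" by (simp add: \<epsilon>_def sum_nonneg)
      have q: "norm (e y - e x - e' (y - x)) = ?q y * norm (y - x)" using n by simp
      have "norm (e y) \<le> norm (e y - e x - e' (y - x)) + norm (e' (y - x))"
        using norm_triangle_ineq[of "e y - e x - e' (y - x)" "e' (y - x)"] by (simp add: ex)
      also have "\<dots> \<le> (?q y + C) * norm (y - x)" using C[of "y - x"] q by (simp add: algebra_simps)
      finally have "norm (e y) \<le> (?q y + C) * norm (y - x)" .
      then have "2 * \<epsilon> y * norm (e y) \<le> 2 * \<epsilon> y * ((?q y + C) * norm (y - x))"
        using \<epsilon>p by (intro mult_left_mono) auto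
      moreover have "norm (z y - z x - e' (y - x)) \<le> norm ((z y - z x) - e y) + norm (e y - e x - e' (y - x))"
        using norm_triangle_ineq[of "(z y - z x) - e y" "e y - e x - e' (y - x)"] by (simp add: ex)
      ultimately have "norm (z y - z x - e' (y - x)) \<le> (2 * \<epsilon> y * (?q y + C) + ?q y) * norm (y - x)"
        using bnd[OF elim(2,1)] q by (simp add: algebra_simps)
      then show ?case using n by (simp add: divide_le_eq)
    qed
  qed
  then have "(z has_derivative e') (at x)"
    using has_derivative_bounded_linear[OF e'] by (simp add: has_derivative_iff_norm)
  then show ?thesis by (auto simp: differentiable_def)
qed

section \<open>Levi-Civita connection and curvature in a chart\<close>

locale metric_domain =
  fixes S :: "'n::euclidean_space set" and H :: "'n \<Rightarrow> 'n \<Rightarrow> 'n \<Rightarrow> real"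
  assumes open_domain: "open S"
    and bilinear_metric: "x \<in> S \<Longrightarrow> bilinear (H x)"
    and metric_commute: "x \<in> S \<Longrightarrow> H x u v = H x v u"
    and metric_pos: "x \<in> S \<Longrightarrow> u \<noteq> 0 \<Longrightarrow> 0 < H x u u"
    and smooth_metric: "smooth_on S (\<lambda>x. H x u v)"
begin

abbreviation \<Gamma> where "\<Gamma> \<equiv> christoffel H"

lemmas metric_simps =
  bilinear_ladd[OF bilinear_metric] bilinear_radd[OF bilinear_metric]
  bilinear_lsub[OF bilinear_metric] bilinear_rsub[OF bilinear_metric]
  bilinear_lmul[OF bilinear_metric] bilinear_rmul[OF bilinear_metric]
  bilinear_lzero[OF bilinear_metric] bilinear_rzero[OF bilinear_metric]
  bilinear_lneg[OF bilinear_metric] bilinear_rneg[OF bilinear_metric]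

text \<open>Positivity is applied to \<open>u - v\<close>. Vector identities below are proved by
  pairing both sides with an arbitrary vector.\<close>

lemma metric_nondegenerate:
  assumes "x \<in> S" "\<And>w. H x u w = H x v w"
  shows "u = v"
proof (rule ccontr)
  assume "u \<noteq> v"
  then have "0 < H x (u - v) (u - v)" using metric_pos[OF assms(1)] by simp
  also have "\<dots> = 0" using assms by (simp add: metric_simps)
  finally show False by simp
qed

lemma metric_differentiable: "x \<in> S \<Longrightarrow> (\<lambda>y. H y u v) differentiable (at x)"
  by (rule smooth_on_differentiable[OF smooth_metric])

lemma metric_derivative_differentiable:
  "x \<in> S \<Longrightarrow> (\<lambda>y. fderiv (\<lambda>y. H y u v) y w) differentiable (at x)"
  by (rule smooth_on_differentiable[OF smooth_on_fderiv[OF smooth_metric]])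

lemma linear_metric_derivative: "x \<in> S \<Longrightarrow> linear (\<lambda>w. fderiv (\<lambda>y. H y u v) x w)"
  using linear_frechet_derivative[OF metric_differentiable] by (simp add: eta_contract_eq)

lemma bilinear_metric_derivative:
  assumes x: "x \<in> S" shows "bilinear (\<lambda>u v. fderiv (\<lambda>y. H y u v) x w)"
proof -
  have "fderiv (\<lambda>y. H y (u + u') v) x = fderiv (\<lambda>y. H y u v + H y u' v) x"
    "fderiv (\<lambda>y. H y u (v + u')) x = fderiv (\<lambda>y. H y u v + H y u u') x"
    "fderiv (\<lambda>y. H y (a *\<^sub>R u) v) x = fderiv (\<lambda>y. a *\<^sub>R H y u v) x"
    "fderiv (\<lambda>y. H y u (a *\<^sub>R v)) x = fderiv (\<lambda>y. a *\<^sub>R H y u v) x" for u u' v a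
    by (rule fderiv_cong_open[OF open_domain x]; simp add: metric_simps)+
  moreover have "fderiv (\<lambda>y. H y u v + H y u' v') x = (\<lambda>w. fderiv (\<lambda>y. H y u v) x w
      + fderiv (\<lambda>y. H y u' v') x w)"
    for u v u' v'
    by (rule fderiv_eqI) (intro has_derivative_add has_derivative_fderiv metric_differentiable x)
  moreover have "fderiv (\<lambda>y. a *\<^sub>R H y u v) x = (\<lambda>w. a *\<^sub>R fderiv (\<lambda>y. H y u v) x w)"
    for u v a
    by (rule fderiv_eqI) (intro has_derivative_scaleR_right has_derivative_fderiv metric_differentiable x)
  ultimately show ?thesis
    unfolding bilinear_def by (auto intro!: linearI)
qed

section \<open>Lowering an index\<close>

text \<open>The musical isomorphism of the metric, with covectors identified with vectors through
  the Euclidean inner product. As an endomorphism of the model space it is bijective as soon as it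
  is injective, and it can serve as the matrix of a linear system.\<close>

definition lower :: "'n \<Rightarrow> 'n \<Rightarrow> 'n" where
  "lower x z = (\<Sum>b\<in>Basis. H x z b *\<^sub>R b)"

lemma linear_lower: "x \<in> S \<Longrightarrow> linear (lower x)"
  unfolding lower_def
  by (rule linearI) (simp_all add: metric_simps sum.distrib scaleR_add_left scaleR_sum_right)

lemma lower_inner: "b \<in> Basis \<Longrightarrow> lower x z \<bullet> b = H x z b"
  by (simp add: lower_def)

lemma metric_eq_on_Basis:
  assumes x: "x \<in> S" and \<phi>: "linear \<phi>" and eq: "\<And>b. b \<in> Basis \<Longrightarrow> H x z b = \<phi> b"
  shows "H x z w = \<phi> w"
proof -
  have "linear (H x z)" using bilinear_metric[OF x] by (simp add: bilinear_def)
  from linear_eq_stdbasis[OF this \<phi>] eq show ?thesis by metis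
qed

lemma inj_lower:
  assumes x: "x \<in> S" shows "inj (lower x)"
proof (rule injI)
  fix z z' assume eq: "lower x z = lower x z'"
  have "linear (H x z')" using bilinear_metric[OF x] by (simp add: bilinear_def)
  moreover have "H x z b = H x z' b" if "b \<in> Basis" for b
    using lower_inner[OF that, of x z] lower_inner[OF that, of x z'] eq by simp
  ultimately show "z = z'"
    using metric_nondegenerate[OF x] metric_eq_on_Basis[OF x] by blast
qed

lemma riesz_representation:
  assumes x: "x \<in> S" and \<phi>: "linear \<phi>"
  shows "\<exists>z. \<forall>w. H x z w = \<phi> w"
proof -
  obtain z where z: "lower x z = (\<Sum>b\<in>Basis. \<phi> b *\<^sub>R b)"
    using linear_injective_imp_surjective[OF linear_lower inj_lower, OF x x] by (metis surjD)
  have "H x z b = \<phi> b" if "b \<in> Basis" for b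
    using lower_inner[OF that, of x z] that by (simp add: z)
  then show ?thesis using metric_eq_on_Basis[OF x \<phi>] by blast
qed

section \<open>Existence, uniqueness and regularity of the Levi-Civita connection\<close>

abbreviation levi_civita :: "'n \<Rightarrow> ('n \<Rightarrow> 'n \<Rightarrow> 'n) \<Rightarrow> bool" where
  "levi_civita x C \<equiv> bilinear C \<and> (\<forall>u v. C u v = C v u) \<and>
     (\<forall>u v w. fderiv (\<lambda>y. H y u v) x w = H x (C w u) v + H x u (C w v))"

text \<open>Compatibility is written for the three positions of the differentiating vector; in the
  alternating sum, symmetry of \<open>C\<close> cancels everything except twice one term.\<close>

lemma koszul:
  assumes x: "x \<in> S" and C: "levi_civita x C"
  shows "2 * H x (C u v) w = fderiv (\<lambda>y. H y v w) x u + fderiv (\<lambda>y. H y u w) x v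
      - fderiv (\<lambda>y. H y u v) x w"
proof -
  have c: "C w' u' = C u' w'" for u' w' using C by blast
  have d: "fderiv (\<lambda>y. H y u v) x w = H x (C w u) v + H x u (C w v)" for u v w
    using C by blast
  have "H x u (C w v) = H x (C v w) u" "H x (C w u) v = H x v (C u w)" "H x u (C v w)
      = H x (C v w) u" "H x v (C u w) = H x (C u w) v"
    by (metis c metric_commute[OF x])+
  then show ?thesis unfolding d by (simp add: c[of v u])
qed

text \<open>The Koszul formula is read as a definition: its right-hand side is linear in
  \<open>w\<close>, hence represented by a vector, and the required properties of that vector follow
  by nondegeneracy.\<close>

lemma levi_civita_exists:
  assumes x: "x \<in> S"
  shows "\<exists>C. levi_civita x C"
proof -
  define k where "k u v w = (fderiv (\<lambda>y. H y v w) x u + fderiv (\<lambda>y. H y u w) x v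
      - fderiv (\<lambda>y. H y u v) x w) / 2" for u v w
  note simps = bilinear_ladd[OF bilinear_metric_derivative[OF x]] bilinear_radd[OF bilinear_metric_derivative[OF x]]
    bilinear_lmul[OF bilinear_metric_derivative[OF x]] bilinear_rmul[OF bilinear_metric_derivative[OF x]]
    linear_add[OF linear_metric_derivative[OF x]] linear_cmul[OF linear_metric_derivative[OF x]]
  have sym: "fderiv (\<lambda>y. H y u v) x = fderiv (\<lambda>y. H y v u) x" for u v
    by (rule fderiv_cong_open[OF open_domain x]) (rule metric_commute)
  have "linear (k u v)" for u v
    by (rule linearI) (simp_all add: k_def simps algebra_simps add_divide_distrib diff_divide_distrib)
  then have "\<forall>u v. \<exists>z. \<forall>w. H x z w = k u v w" using riesz_representation[OF x] by blast
  then obtain C where C: "\<And>u v w. H x (C u v) w = k u v w" by metis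
  have "C u v = C v u" for u v
    by (rule metric_nondegenerate[OF x]) (simp add: C k_def sym[of u v])
  moreover have "bilinear C"
  proof -
    have "C (u + u') v = C u v + C u' v" "C v (u + u') = C v u + C v u'"
      "C (a *\<^sub>R u) v = a *\<^sub>R C u v" "C v (a *\<^sub>R u) = a *\<^sub>R C v u" for u u' v a
      by (rule metric_nondegenerate[OF x],
        simp add: C metric_simps[OF x] k_def simps algebra_simps add_divide_distrib diff_divide_distrib)+
    then show ?thesis unfolding bilinear_def by (auto intro!: linearI)
  qed
  moreover have "fderiv (\<lambda>y. H y u v) x w = H x (C w u) v + H x u (C w v)" for u v w
    unfolding metric_commute[OF x, of u] C k_def sym[of v u] by (simp add: sym[of v w] field_simps)
  ultimately show ?thesis by blast
qed

lemma christoffel: "x \<in> S \<Longrightarrow> levi_civita x (\<Gamma> x)"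
proof -
  assume x: "x \<in> S"
  have "\<exists>!C. levi_civita x C"
  proof (rule ex_ex1I[OF levi_civita_exists[OF x]])
    fix C C' assume "levi_civita x C" "levi_civita x C'"
    from koszul[OF x this(1)] koszul[OF x this(2)] show "C = C'"
      by (intro ext metric_nondegenerate[OF x]) (metis mult_cancel_left zero_neq_numeral)
  qed
  then show ?thesis unfolding christoffel_def by (rule theI')
qed

lemma bilinear_christoffel: "x \<in> S \<Longrightarrow> bilinear (\<Gamma> x)"
  and christoffel_commute: "x \<in> S \<Longrightarrow> \<Gamma> x u v = \<Gamma> x v u"
  and metric_derivative: "x \<in> S \<Longrightarrow> fderiv (\<lambda>y. H y u v) x w = H x (\<Gamma> x w u) v + H x u (\<Gamma> x w v)"
  using christoffel by blast+

lemmas christoffel_simps =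
  bilinear_ladd[OF bilinear_christoffel] bilinear_radd[OF bilinear_christoffel]
  bilinear_lsub[OF bilinear_christoffel] bilinear_rsub[OF bilinear_christoffel]
  bilinear_lmul[OF bilinear_christoffel] bilinear_rmul[OF bilinear_christoffel]
  bilinear_lzero[OF bilinear_christoffel] bilinear_rzero[OF bilinear_christoffel]

text \<open>Lowering \<open>\<Gamma> y u v\<close> gives half of the Koszul expression, which is
  differentiable because the metric has differentiable first derivatives. So \<open>\<Gamma>\<close>
  solves an injective linear system with differentiable coefficients.\<close>

lemma christoffel_differentiable:
  assumes x: "x \<in> S"
  shows "(\<lambda>y. \<Gamma> y u v) differentiable (at x)"
proof (rule linear_solution_differentiable[where L = lower, OF open_domain x linear_lower inj_lower[OF x]])
  let ?k = "\<lambda>y. \<Sum>b\<in>Basis. ((fderiv (\<lambda>y. H y v b) y u + fderiv (\<lambda>y. H y u b) y v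
      - fderiv (\<lambda>y. H y u v) y b) / 2) *\<^sub>R b"
  show "(\<lambda>y. lower y z) differentiable (at x)" for z
    unfolding lower_def
    by (intro differentiable_sum finite_Basis ballI differentiable_scaleR differentiable_const metric_differentiable[OF x])
  show "?k differentiable (at x)"
    unfolding divide_inverse
    by (intro differentiable_sum finite_Basis ballI differentiable_scaleR
        differentiable_mult differentiable_add
            differentiable_diff differentiable_const metric_derivative_differentiable[OF x])
  show "lower y (\<Gamma> y u v) = ?k y" if "y \<in> S" for y
    using koszul[OF that christoffel[OF that], of u v] unfolding lower_def
    by (intro sum.cong) (auto simp: field_simps)
qed

text \<open>The derivative of the coefficients of \<open>H\<close> is absorbed into the
  \<open>\<Gamma>\<close> terms, so the two brackets are the covariant derivatives of
  \<open>a\<close> and \<open>b\<close> along \<open>w\<close>.\<close>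

lemma metric_has_derivative:
  assumes x: "x \<in> S" and a: "(a has_derivative a') (at x)" and b: "(b has_derivative b') (at x)"
  shows "((\<lambda>y. H y (a y) (b y)) has_derivative
    (\<lambda>w. H x (a' w + \<Gamma> x w (a x)) (b x) + H x (a x) (b' w + \<Gamma> x w (b x)))) (at x)"
  using has_derivative_bilinear_family[OF open_domain x bilinear_metric metric_differentiable[OF x] a b]
  by (simp add: metric_derivative[OF x] metric_simps[OF x] algebra_simps)

section \<open>Symmetries of the curvature tensor\<close>

lemma curvature_eq:
  assumes x: "x \<in> S"
  shows "curvature H x u v w = fderiv (\<lambda>y. \<Gamma> y v w) x u - fderiv (\<lambda>y. \<Gamma> y u w) x v
    + \<Gamma> x u (\<Gamma> x v w) - \<Gamma> x v (\<Gamma> x u w)"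
proof -
  have "cov H (\<lambda>_. u) (\<lambda>_. w) = (\<lambda>y. \<Gamma> y u w)" for u w
    by (simp add: cov_def fun_eq_iff)
  then show ?thesis
    by (simp add: curvature_def curvature_field_def) (simp add: cov_def lie_bracket_def christoffel_simps[OF x])
qed

lemma christoffel_derivative_commute:
  "x \<in> S \<Longrightarrow> fderiv (\<lambda>y. \<Gamma> y u v) x = fderiv (\<lambda>y. \<Gamma> y v u) x"
  by (rule fderiv_cong_open[OF open_domain]) (auto intro: christoffel_commute)

text \<open>Once every \<open>\<Gamma>\<close> is written with its arguments in one fixed order, the
  twelve terms of the cyclic sum cancel in pairs.\<close>

lemma curvature_bianchi:
  assumes x: "x \<in> S"
  shows "curvature H x u v w + curvature H x v w u + curvature H x w u v = 0"
  unfolding curvature_eq[OF x] christoffel_derivative_commute[OF x, of w u] christoffel_derivative_commute[OF x, of w v]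
    christoffel_derivative_commute[OF x, of v u] christoffel_commute[OF x, of w u] christoffel_commute[OF x, of w v]
    christoffel_commute[OF x, of v u]
  by simp

lemma curvature_swap: "x \<in> S \<Longrightarrow> curvature H x u v w = - curvature H x v u w"
  by (simp add: curvature_eq)

text \<open>Two derivatives of \<open>H y w z\<close> are expressed through \<open>\<Gamma>\<close>
  and commute. On exchanging \<open>u\<close> and \<open>v\<close> the two mixed products of
  Christoffel terms are swapped, so they drop out of the difference, and what remains are the
  curvature terms.\<close>

lemma curvature_skew:
  assumes x: "x \<in> S"
  shows "H x (curvature H x u v w) z + H x w (curvature H x u v z) = 0"
proof -
  have "fderiv (\<lambda>y. fderiv (\<lambda>y. H y w z) y v) x u =
      H x (fderiv (\<lambda>y. \<Gamma> y v w) x u + \<Gamma> x u (\<Gamma> x v w)) z + H x (\<Gamma> x v w) (\<Gamma> x u z)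
      + H x (\<Gamma> x u w) (\<Gamma> x v z) + H x w (fderiv (\<lambda>y. \<Gamma> y v z) x u + \<Gamma> x u (\<Gamma> x v z))"
    (is "_ = ?R u v") for u v
  proof -
    have "((\<lambda>y. H y (\<Gamma> y v w) z)
        has_derivative (\<lambda>u. H x (fderiv (\<lambda>y. \<Gamma> y v w) x u + \<Gamma> x u (\<Gamma> x v w)) z
            + H x (\<Gamma> x v w) (0 + \<Gamma> x u z))) (at x)"
      "((\<lambda>y. H y w (\<Gamma> y v z)) has_derivative (\<lambda>u. H x (0 + \<Gamma> x u w) (\<Gamma> x v z)
          + H x w (fderiv (\<lambda>y. \<Gamma> y v z) x u + \<Gamma> x u (\<Gamma> x v z)))) (at x)"
      by (rule metric_has_derivative[OF x] has_derivative_const has_derivative_fderiv[OF christoffel_differentiable[OF x]])+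
    from has_derivative_add[OF this]
    have "((\<lambda>y. H y (\<Gamma> y v w) z + H y w (\<Gamma> y v z)) has_derivative (\<lambda>u. ?R u v)) (at x)"
      by (simp add: add.assoc)
    then have "((\<lambda>y. fderiv (\<lambda>y. H y w z) y v) has_derivative (\<lambda>u. ?R u v)) (at x)"
      by (rule has_derivative_transform_within_open[OF _ open_domain x]) (simp add: metric_derivative)
    then show ?thesis by (simp add: fderiv_eqI)
  qed
  moreover have "fderiv (\<lambda>y. fderiv (\<lambda>y. H y w z) y v) x u = fderiv (\<lambda>y. fderiv (\<lambda>y. H y w z) y u) x v"
    by (rule second_derivative_symmetric[OF open_domain x metric_differentiable metric_derivative_differentiable[OF x]])
  ultimately have "?R u v = ?R v u" by simp
  then show ?thesis by (simp add: curvature_eq[OF x] metric_simps[OF x])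
qed

end

section \<open>Killing fields in a chart\<close>

locale killing_domain = metric_domain +
  fixes Z :: "'a \<Rightarrow> 'a"
  assumes smooth_Z: "smooth_on S Z"
    and killing: "x \<in> S \<Longrightarrow> lie_derivative_metric H Z x u v = 0"
begin

abbreviation dZ :: "'a \<Rightarrow> 'a \<Rightarrow> 'a" where
  "dZ x u \<equiv> cov H (\<lambda>_. u) Z x"

text \<open>The second covariant derivative \<open>(\<nabla>\<^sup>2Z)(w, u)\<close>.\<close>

definition ddZ :: "'a \<Rightarrow> 'a \<Rightarrow> 'a \<Rightarrow> 'a" where
  "ddZ x w u = fderiv (\<lambda>y. dZ y u) x w + \<Gamma> x w (dZ x u) - dZ x (\<Gamma> x w u)"

lemma Z_differentiable: "x \<in> S \<Longrightarrow> Z differentiable (at x)"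
  by (rule smooth_on_differentiable[OF smooth_Z])

lemma Z_derivative_differentiable: "x \<in> S \<Longrightarrow> (\<lambda>y. fderiv Z y u) differentiable (at x)"
  by (rule smooth_on_differentiable[OF smooth_on_fderiv[OF smooth_Z]])

lemma dZ_eq: "dZ x u = fderiv Z x u + \<Gamma> x u (Z x)"
  by (simp add: cov_def)

lemma linear_dZ: "x \<in> S \<Longrightarrow> linear (dZ x)"
  using linear_frechet_derivative[OF Z_differentiable]
  by (intro linearI) (simp_all add: dZ_eq linear_add linear_cmul christoffel_simps scaleR_add_right)

text \<open>The Killing equation in covariant form: brackets with constant fields contribute the
  derivatives of \<open>Z\<close>, and the derivative of \<open>H\<close> along \<open>Z\<close>
  contributes the Christoffel terms after exchanging their arguments.\<close>

lemma dZ_skew: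
  assumes x: "x \<in> S"
  shows "H x (dZ x u) v + H x u (dZ x v) = 0"
proof -
  have "lie_bracket Z (\<lambda>_. u) x = 0 - fderiv Z x u" for u by (simp add: lie_bracket_def)
  then show ?thesis
    using killing[OF x, of u v]
    by (simp add: lie_derivative_metric_def dZ_eq metric_simps[OF x] metric_derivative[OF x] christoffel_commute[OF x, of "Z x"])
qed

lemma dZ_has_derivative:
  assumes x: "x \<in> S"
  shows "((\<lambda>y. dZ y u) has_derivative
    (\<lambda>w. fderiv (\<lambda>y. fderiv Z y u) x w + (fderiv (\<lambda>y. \<Gamma> y u (Z x)) x w + \<Gamma> x u (fderiv Z x w)))) (at x)"
proof -
  have "((\<lambda>y. \<Gamma> y u (Z y)) has_derivative
     (\<lambda>w. fderiv (\<lambda>y. \<Gamma> y u (Z x)) x w + \<Gamma> x u (fderiv Z x w))) (at x)"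
    by (rule has_derivative_linear_family[OF open_domain x])
      (auto simp: has_derivative_fderiv Z_differentiable christoffel_differentiable x dest: bilinear_christoffel simp: bilinear_def)
  then show ?thesis unfolding dZ_eq
    by (intro has_derivative_add has_derivative_fderiv Z_derivative_differentiable x)
qed

text \<open>\<open>dZ_skew\<close> is differentiated along \<open>w\<close>. The terms in which the
  derivative falls on \<open>u\<close> or \<open>v\<close> involve only
  \<open>\<Gamma> x w u\<close> and \<open>\<Gamma> x w v\<close>, and are removed by
  \<open>dZ_skew\<close> applied to these vectors.\<close>

lemma ddZ_skew:
  assumes x: "x \<in> S"
  shows "H x (ddZ x w u) v + H x u (ddZ x w v) = 0"
proof -
  have "((\<lambda>y. H y (dZ y u) v) has_derivative (\<lambda>w. H x (fderiv (\<lambda>y. dZ y u) x w + \<Gamma> x w (dZ x u)) v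
      + H x (dZ x u) (0 + \<Gamma> x w v))) (at x)"
    "((\<lambda>y. H y u (dZ y v)) has_derivative (\<lambda>w. H x (0 + \<Gamma> x w u) (dZ x v)
        + H x u (fderiv (\<lambda>y. dZ y v) x w + \<Gamma> x w (dZ x v)))) (at x)"
    using dZ_has_derivative[OF x]
    by (intro metric_has_derivative[OF x] has_derivative_const has_derivative_fderiv differentiableI; blast)+
  from has_derivative_add[OF this] have
    "((\<lambda>y. 0) has_derivative (\<lambda>w. H x (fderiv (\<lambda>y. dZ y u) x w + \<Gamma> x w (dZ x u)) v
        + H x (dZ x u) (0 + \<Gamma> x w v)
      + (H x (0 + \<Gamma> x w u) (dZ x v) + H x u (fderiv (\<lambda>y. dZ y v) x w + \<Gamma> x w (dZ x v))))) (at x)"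
    by (rule has_derivative_transform_within_open[OF _ open_domain x]) (simp add: dZ_skew)
  from has_derivative_unique[OF this has_derivative_const]
  have "H x (fderiv (\<lambda>y. dZ y u) x w + \<Gamma> x w (dZ x u)) v + H x (dZ x u) (0 + \<Gamma> x w v)
      + (H x (0 + \<Gamma> x w u) (dZ x v) + H x u (fderiv (\<lambda>y. dZ y v) x w + \<Gamma> x w (dZ x v))) = 0"
    by (rule fun_cong)
  moreover have "H x (dZ x (\<Gamma> x w u)) v + H x (\<Gamma> x w u) (dZ x v) = 0" "H x (dZ x u) (\<Gamma> x w v)
      + H x u (dZ x (\<Gamma> x w v)) = 0"
    by (rule dZ_skew[OF x])+
  ultimately show ?thesis by (simp add: ddZ_def metric_simps[OF x])
qed

text \<open>Second derivatives of \<open>Z\<close> cancel by symmetry, the correction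
  \<open>dZ x (\<Gamma> x w u)\<close> by symmetry of \<open>\<Gamma>\<close>, and the products of
  \<open>\<Gamma>\<close> with first derivatives of \<open>Z\<close> in pairs.\<close>

lemma ricci_identity:
  assumes x: "x \<in> S"
  shows "ddZ x w u - ddZ x u w = curvature H x w u (Z x)"
proof -
  have "fderiv (\<lambda>y. fderiv Z y u) x w = fderiv (\<lambda>y. fderiv Z y w) x u"
    by (rule second_derivative_symmetric[OF open_domain x Z_differentiable Z_derivative_differentiable[OF x]])
  then show ?thesis
    unfolding ddZ_def fderiv_eqI[OF dZ_has_derivative[OF x]] curvature_eq[OF x]
    by (simp add: dZ_eq christoffel_simps[OF x] christoffel_commute[OF x, of u w])
qed

text \<open>The difference of the two sides, lowered with the metric, is a trilinear form that is
  symmetric in one pair and skew in the other pair of neighbouring arguments, hence zero.\<close>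

lemma killing_identity:
  assumes x: "x \<in> S"
  shows "ddZ x w u = curvature H x w (Z x) u"
proof (rule metric_nondegenerate[OF x])
  fix v
  define D where "D w u v = H x (ddZ x w u - curvature H x w (Z x) u) v" for w u v
  have skew: "D w u v = - D w v u" for w u v
    using ddZ_skew[OF x, of w u v] curvature_skew[OF x, of w "Z x" u v]
      metric_commute[OF x, of "ddZ x w v"] metric_commute[OF x, of "curvature H x w (Z x) v"]
    by (simp add: D_def metric_simps[OF x])
  have sym: "D w u v = D u w v" for w u v
  proof -
    \<comment> \<open>By the Bianchi identity the curvature side has the same antisymmetric part in
      \<open>w\<close> and \<open>u\<close> as \<open>ddZ\<close>, whose antisymmetric part is given
      by \<open>ricci_identity\<close>.\<close>
    have "curvature H x w (Z x) u - curvature H x u (Z x) w = curvature H x w u (Z x)"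
      using curvature_bianchi[OF x, of w "Z x" u] curvature_swap[OF x, of "Z x" u w] curvature_swap[OF x, of u w "Z x"]
      by (simp add: algebra_simps eq_neg_iff_add_eq_0)
    then have "ddZ x w u - curvature H x w (Z x) u = ddZ x u w - curvature H x u (Z x) w"
      using ricci_identity[OF x, of w u] by (simp add: algebra_simps)
    then show ?thesis by (simp add: D_def)
  qed
  \<comment> \<open>Alternating the two symmetries runs through all six orders of the arguments and
    returns to \<open>D w u v\<close> after three sign changes, so it equals its own
    negative.\<close>
  have "D w u v = 0"
    using skew[of w u v] sym[of w v u] skew[of v w u] sym[of v u w] skew[of u v w] sym[of u w v] by linarith
  then show "H x (ddZ x w u) v = H x (curvature H x w (Z x) u) v"
    by (simp add: D_def metric_simps[OF x])
qed

lemma cov_self_zero: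
  assumes const: "\<And>y. y \<in> S \<Longrightarrow> H y (Z y) (Z y) = k" and x: "x \<in> S"
  shows "dZ x (Z x) = 0"
proof (rule metric_nondegenerate[OF x])
  fix w
  have "((\<lambda>y. H y (Z y) (Z y)) has_derivative
     (\<lambda>w. H x (fderiv Z x w + \<Gamma> x w (Z x)) (Z x) + H x (Z x) (fderiv Z x w + \<Gamma> x w (Z x)))) (at x)"
    by (intro metric_has_derivative[OF x] has_derivative_fderiv Z_differentiable x)
  then have "((\<lambda>y. k) has_derivative
     (\<lambda>w. H x (fderiv Z x w + \<Gamma> x w (Z x)) (Z x) + H x (Z x) (fderiv Z x w + \<Gamma> x w (Z x)))) (at x)"
    by (rule has_derivative_transform_within_open[OF _ open_domain x]) (rule const)
  from has_derivative_unique[OF this has_derivative_const]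
  have "H x (dZ x w) (Z x) + H x (Z x) (dZ x w) = 0" unfolding dZ_eq by (rule fun_cong)
  then have "H x (Z x) (dZ x w) = 0" using metric_commute[OF x, of "Z x"] by simp
  then show "H x (dZ x (Z x)) w = H x 0 w"
    using dZ_skew[OF x, of "Z x" w] by (simp add: metric_simps[OF x])
qed

section \<open>Second covariant derivative and bitension along a map\<close>

text \<open>Along \<open>f\<close> the first covariant derivative is \<open>dZ\<close> applied to
  the differential of \<open>f\<close>. Differentiating this product, the derivative of the
  differential leads to the second fundamental form and that of \<open>dZ\<close> to
  \<open>ddZ\<close>; the term
  \<open>dZ (f x) (\<Gamma> (f x) (fderiv f x u) (fderiv f x v))\<close> occurs in the two with
  opposite signs.\<close>

lemma second_cov_compose:
  fixes f :: "'m::euclidean_space \<Rightarrow> 'a"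
  assumes U: "open U" "x \<in> U" and fU: "f ` U \<subseteq> S" and f: "smooth_on U f"
    and \<sigma>: "\<And>y. y \<in> U \<Longrightarrow> \<sigma> y = Z (f y)"
  shows "second_cov G H f \<sigma> x u v =
    dZ (f x) (second_fundamental_form G H f x u v) + ddZ (f x) (fderiv f x u) (fderiv f x v)"
proof -
  have fS: "f y \<in> S" if "y \<in> U" for y using that fU by blast
  have fd: "(f has_derivative fderiv f y) (at y)" if "y \<in> U" for y
    by (rule has_derivative_fderiv[OF smooth_on_differentiable[OF f that]])
  have \<sigma>d: "fderiv \<sigma> y v = fderiv Z (f y) (fderiv f y v)" if "y \<in> U" for y v
  proof -
    have "((\<lambda>y. Z (f y)) has_derivative (\<lambda>v. fderiv Z (f y) (fderiv f y v))) (at y)"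
      by (rule has_derivative_compose[OF fd[OF that] has_derivative_fderiv[OF Z_differentiable[OF fS[OF that]]]])
    then have "(\<sigma> has_derivative (\<lambda>v. fderiv Z (f y) (fderiv f y v))) (at y)"
      by (rule has_derivative_transform_within_open[OF _ U(1) that]) (simp add: \<sigma>)
    then show ?thesis by (simp add: fderiv_eqI)
  qed
  have pc: "pullback_cov H f X \<sigma> y = dZ (f y) (fderiv f y (X y))" if "y \<in> U" for X y
    using that by (simp add: pullback_cov_def dZ_eq \<sigma> \<sigma>d)
  have fd2: "((\<lambda>y. fderiv f y v) has_derivative fderiv (\<lambda>y. fderiv f y v) x) (at x)" for v
    by (rule has_derivative_fderiv[OF smooth_on_differentiable[OF smooth_on_fderiv[OF f] U(2)]])
  have comp: "((\<lambda>y. dZ (f y) w)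
      has_derivative (\<lambda>u. fderiv (\<lambda>q. dZ q w) (f x) (fderiv f x u))) (at x)" for w
    using has_derivative_compose[OF fd[OF U(2)] has_derivative_fderiv[OF differentiableI[OF dZ_has_derivative[OF fS[OF U(2)]]]]] .
  have "((\<lambda>y. dZ (f y) (fderiv f y v)) has_derivative
    (\<lambda>u. fderiv (\<lambda>y. dZ (f y) (fderiv f x v)) x u + dZ (f x) (fderiv (\<lambda>y. fderiv f y v) x u))) (at x)"
    by (rule has_derivative_linear_family[OF U linear_dZ[OF fS] differentiableI[OF comp] fd2])
  then have "(pullback_cov H f (\<lambda>_. v) \<sigma> has_derivative
    (\<lambda>u. fderiv (\<lambda>y. dZ (f y) (fderiv f x v)) x u + dZ (f x) (fderiv (\<lambda>y. fderiv f y v) x u))) (at x)"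
    by (rule has_derivative_transform_within_open[OF _ U]) (simp add: pc)
  then have "fderiv (pullback_cov H f (\<lambda>_. v) \<sigma>) x u =
     fderiv (\<lambda>q. dZ q (fderiv f x v)) (f x) (fderiv f x u) + dZ (f x) (fderiv (\<lambda>y. fderiv f y v) x u)"
    by (simp add: fderiv_eqI fderiv_eqI[OF comp])
  then have "second_cov G H f \<sigma> x u v =
     fderiv (\<lambda>q. dZ q (fderiv f x v)) (f x) (fderiv f x u) + dZ (f x) (fderiv (\<lambda>y. fderiv f y v) x u)
     + \<Gamma> (f x) (fderiv f x u) (dZ (f x) (fderiv f x v)) - dZ (f x) (fderiv f x (cov G (\<lambda>_. u) (\<lambda>_. v) x))"
    unfolding second_cov_def pc[OF U(2)] by (subst pullback_cov_def) (simp add: pc[OF U(2)])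
  moreover have "second_fundamental_form G H f x u v = fderiv (\<lambda>y. fderiv f y v) x u
     + \<Gamma> (f x) (fderiv f x u) (fderiv f x v) - fderiv f x (cov G (\<lambda>_. u) (\<lambda>_. v) x)"
    by (simp add: second_fundamental_form_def pullback_cov_def)
  ultimately show ?thesis
    by (simp add: ddZ_def linear_add[OF linear_dZ[OF fS[OF U(2)]]] linear_diff[OF linear_dZ[OF fS[OF U(2)]]])
qed

text \<open>Both traces are sums over the same chosen set \<open>?E\<close>, so the curvature terms
  cancel summand by summand, and linearity moves \<open>dZ\<close> outside the remaining
  sum.\<close>

lemma local_bitension_zero:
  fixes f :: "'m::euclidean_space \<Rightarrow> 'a"
  assumes U: "open U" "x \<in> U" and fU: "f ` U \<subseteq> S" and f: "smooth_on U f"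
    and \<sigma>: "\<And>y. y \<in> U \<Longrightarrow> \<sigma> y = Z (f y)"
    and const: "\<And>y. y \<in> S \<Longrightarrow> H y (Z y) (Z y) = k"
    and tension: "local_tension G H f x = Z (f x)"
  shows "local_bitension G H f \<sigma> x = 0"
proof -
  have fx: "f x \<in> S" using fU U by blast
  let ?E = "SOME E. orthonormal_basis (G x) E"
  have "second_cov G H f \<sigma> x e e = dZ (f x) (second_fundamental_form G H f x e e)
      + curvature H (f x) (fderiv f x e) (Z (f x)) (fderiv f x e)" for e
    using second_cov_compose[where \<sigma> = \<sigma>, OF U fU f \<sigma>] by (simp add: killing_identity[OF fx])
  then have "local_bitension G H f \<sigma> x =
     (\<Sum>e\<in>?E. dZ (f x) (second_fundamental_form G H f x e e))"
    by (simp add: local_bitension_def rough_laplacian_def metric_trace_def \<sigma>[OF U(2)] sum.distrib)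
  also have "\<dots> = dZ (f x) (local_tension G H f x)"
    unfolding local_tension_def metric_trace_def by (rule linear_sum[OF linear_dZ[OF fx], symmetric])
  also have "\<dots> = 0" unfolding tension by (rule cov_self_zero[OF const fx])
  finally show ?thesis .
qed

end

section \<open>Charts and tangent vectors\<close>

locale smooth_manifold_charts =
  fixes N :: "('b, 'n::euclidean_space) manifold"
  assumes smooth_manifold: "smooth_manifold N"
begin

lemma chart_topology:
  assumes "d \<in> atlas N"
  shows "openin (mtop N) (chart_dom d)" "open (chart_img d)"
    and "homeomorphic_map (subtopology (mtop N) (chart_dom d)) (top_of_set (chart_img d)) (chart_map d)"
    and "inj_on (chart_map d) (chart_dom d)" "chart_dom d \<subseteq> points N"
proof -
  show op: "openin (mtop N) (chart_dom d)" "open (chart_img d)"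
    and hom: "homeomorphic_map (subtopology (mtop N) (chart_dom d)) (top_of_set (chart_img d)) (chart_map d)"
    using smooth_manifold assms unfolding smooth_manifold_def is_chart_def by auto
  show sub: "chart_dom d \<subseteq> points N" using op by (simp add: openin_subset)
  show "inj_on (chart_map d) (chart_dom d)"
    using homeomorphic_imp_injective_map[OF hom] sub by (simp add: Int_absorb1)
qed

lemma chart_inv_chart_map:
  "d \<in> atlas N \<Longrightarrow> p \<in> chart_dom d \<Longrightarrow> chart_inv d (chart_map d p) = p"
  unfolding chart_inv_def by (rule inv_into_f_f[OF chart_topology(4)])

lemma chart_inv_in_dom: "x \<in> chart_img d \<Longrightarrow> chart_inv d x \<in> chart_dom d"
  unfolding chart_inv_def chart_img_def by (rule inv_into_into)

lemma open_chart_image: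
  assumes d: "d \<in> atlas N" and U: "openin (mtop N) U" "U \<subseteq> chart_dom d"
  shows "open (chart_map d ` U)"
proof -
  have "openin (subtopology (mtop N) (chart_dom d)) U"
    using U openin_subtopology by blast
  then have "openin (top_of_set (chart_img d)) (chart_map d ` U)"
    using homeomorphic_imp_open_map[OF chart_topology(3)[OF d]] by (simp add: open_map_def)
  then show ?thesis using openin_open_trans chart_topology(2)[OF d] by blast
qed

section \<open>Transition maps and components of tangent vectors\<close>

lemma transition_chart_map:
  "d \<in> atlas N \<Longrightarrow> p \<in> chart_dom d \<Longrightarrow> transition d d' (chart_map d p) = chart_map d' p"
  by (simp add: transition_def chart_inv_chart_map)

lemma transition_has_derivative:
  assumes "d \<in> charts_at N p" "d' \<in> charts_at N p"
  shows "(transition d d' has_derivative fderiv (transition d d') (chart_map d p)) (at (chart_map d p))"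
proof (rule has_derivative_fderiv, rule smooth_on_differentiable)
  show "smooth_on (chart_map d ` (chart_dom d \<inter> chart_dom d')) (transition d d')"
    using smooth_manifold assms unfolding smooth_manifold_def charts_at_def by blast
  show "chart_map d p \<in> chart_map d ` (chart_dom d \<inter> chart_dom d')"
    using assms by (auto simp: charts_at_def)
qed

lemma linear_transition:
  "d \<in> charts_at N p \<Longrightarrow> d' \<in> charts_at N p \<Longrightarrow> linear (fderiv (transition d d') (chart_map d p))"
  using transition_has_derivative has_derivative_linear by blast

text \<open>The chain rule on the image \<open>W\<close> of the triple overlap. It is what makes the
  components given by \<open>tangent_of\<close> compatible for every pair of charts.\<close>

lemma transition_cocycle:
  assumes c: "c \<in> charts_at N p" and c': "c' \<in> charts_at N p" and c'': "c'' \<in> charts_at N p"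
  shows "fderiv (transition c c'') (chart_map c p) u =
    fderiv (transition c' c'') (chart_map c' p) (fderiv (transition c c') (chart_map c p) u)"
proof -
  have at: "c \<in> atlas N" "c' \<in> atlas N" "c'' \<in> atlas N"
    and p: "p \<in> chart_dom c" "p \<in> chart_dom c'" "p \<in> chart_dom c''"
    using c c' c'' by (auto simp: charts_at_def)
  define W where "W = chart_map c ` (chart_dom c \<inter> chart_dom c' \<inter> chart_dom c'')"
  have "openin (mtop N) (chart_dom c \<inter> chart_dom c' \<inter> chart_dom c'')"
    by (intro openin_Int chart_topology(1) at)
  then have W: "open W" "chart_map c p \<in> W"
    unfolding W_def using p by (blast intro: open_chart_image[OF at(1)])+
  have "((\<lambda>y. transition c' c'' (transition c c' y)) has_derivative
     (\<lambda>u. fderiv (transition c' c'') (chart_map c' p) (fderiv (transition c c') (chart_map c p) u))) (at (chart_map c p))"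
    by (rule has_derivative_compose[OF transition_has_derivative[OF c c']])
      (use transition_has_derivative[OF c' c''] in \<open>simp add: transition_chart_map at p\<close>)
  then have "(transition c c'' has_derivative
     (\<lambda>u. fderiv (transition c' c'') (chart_map c' p) (fderiv (transition c c') (chart_map c p) u))) (at (chart_map c p))"
  proof (rule has_derivative_transform_within_open[OF _ W])
    fix y assume "y \<in> W"
    then obtain q where "q \<in> chart_dom c" "q \<in> chart_dom c'" "y = chart_map c q"
      unfolding W_def by blast
    then show "transition c' c'' (transition c c' y) = transition c c'' y"
      by (simp add: transition_chart_map at)
  qed
  then show ?thesis by (simp add: fderiv_eqI)
qed

lemma transition_self:
  assumes c: "c \<in> charts_at N p"
  shows "fderiv (transition c c) (chart_map c p) u = u"
proof -
  have at: "c \<in> atlas N" "p \<in> chart_dom c" using c by (auto simp: charts_at_def)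
  have "fderiv (transition c c) (chart_map c p) = fderiv (\<lambda>y. y) (chart_map c p)"
  proof (rule fderiv_cong_open[OF chart_topology(2)[OF at(1)]])
    show "chart_map c p \<in> chart_img c" using at by (simp add: chart_img_def)
    show "transition c c y = y" if "y \<in> chart_img c" for y
      using that at unfolding chart_img_def by (metis imageE transition_chart_map)
  qed
  then show ?thesis by simp
qed

lemma tangent_of_component: "c \<in> charts_at N p \<Longrightarrow> tangent_of N p c u c = u"
  by (simp add: tangent_of_def transition_self)

lemma tangent_of_in_tangent_space:
  assumes c: "c \<in> charts_at N p"
  shows "tangent_of N p c u \<in> tangent_space N p"
proof -
  have "tangent_of N p c u c'' = fderiv (transition c' c'') (chart_map c' p) (tangent_of N p c u c')"
    if "c' \<in> charts_at N p" "c'' \<in> charts_at N p" for c' c''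
    using transition_cocycle[OF c that] that by (simp only: tangent_of_def if_True)
  moreover have "tangent_of N p c u c' = 0" if "c' \<notin> charts_at N p" for c'
    using that by (simp add: tangent_of_def)
  ultimately show ?thesis unfolding tangent_space_def by blast
qed

lemma tangent_of_of_component:
  assumes "c \<in> charts_at N p" "v \<in> tangent_space N p"
  shows "tangent_of N p c (v c) = v"
proof
  fix c'
  have "c' \<in> charts_at N p \<Longrightarrow> v c' = fderiv (transition c c') (chart_map c p) (v c)"
    "c' \<notin> charts_at N p \<Longrightarrow> v c' = 0"
    using assms unfolding tangent_space_def by blast+
  then show "tangent_of N p c (v c) c' = v c'"
    by (cases "c' \<in> charts_at N p") (simp_all add: tangent_of_def)
qed

lemma tangent_of_linear:
  "c \<in> charts_at N p \<Longrightarrow>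
    tangent_of N p c (a *\<^sub>R u + b *\<^sub>R v)
        = (\<lambda>c'. a *\<^sub>R tangent_of N p c u c' + b *\<^sub>R tangent_of N p c v c')"
  by (auto simp: tangent_of_def fun_eq_iff linear_add[OF linear_transition] linear_cmul[OF linear_transition])

lemma tangent_of_zero: "c \<in> charts_at N p \<Longrightarrow> tangent_of N p c 0 = zero_tangent"
  by (auto simp: tangent_of_def zero_tangent_def fun_eq_iff linear_0[OF linear_transition])

lemma chart_at: "p \<in> points N \<Longrightarrow> chart_at N p \<in> charts_at N p"
proof -
  assume "p \<in> points N"
  moreover have "(\<Union>c\<in>atlas N. chart_dom c) = points N"
    using smooth_manifold unfolding smooth_manifold_def by blast
  ultimately have "\<exists>c. c \<in> charts_at N p" unfolding charts_at_def by blast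
  then show ?thesis unfolding chart_at_def by (rule someI_ex)
qed

lemma charts_at_chart_inv: "d \<in> atlas N \<Longrightarrow> x \<in> chart_img d \<Longrightarrow> d \<in> charts_at N (chart_inv d x)"
  by (simp add: charts_at_def chart_inv_in_dom)

section \<open>Metrics and Killing fields read in a chart\<close>

lemma metric_domain_local_metric:
  assumes h: "riemannian_metric N h" and d: "d \<in> atlas N"
  shows "metric_domain (chart_img d) (local_metric N h d)"
proof
  show "open (chart_img d)" by (rule chart_topology(2)[OF d])
  show "smooth_on (chart_img d) (\<lambda>x. local_metric N h d x u v)" for u v
    using h[unfolded riemannian_metric_def, THEN conjunct2] d by blast
  fix x assume x: "x \<in> chart_img d"
  define q where "q = chart_inv d x"
  have dq: "d \<in> charts_at N q" unfolding q_def by (rule charts_at_chart_inv[OF d x])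
  have q: "q \<in> points N" using dq chart_topology(5)[OF d] by (auto simp: charts_at_def)
  note T = tangent_of_in_tangent_space[OF dq]
  note h_q = h[unfolded riemannian_metric_def, THEN conjunct1, THEN bspec, OF q]
  have lm: "local_metric N h d x u v = h q (tangent_of N q d u) (tangent_of N q d v)" for u v
    by (simp add: local_metric_def q_def Let_def)
  show comm: "local_metric N h d x u v = local_metric N h d x v u" for u v
    unfolding lm by (rule h_q[THEN conjunct1, rule_format, OF T T])
  have lin: "local_metric N h d x (a *\<^sub>R u + b *\<^sub>R v) w
      = a * local_metric N h d x u w + b * local_metric N h d x v w" for a b u v w
    unfolding lm tangent_of_linear[OF dq]
    by (rule h_q[THEN conjunct2, THEN conjunct1, rule_format, OF T T T])
  have 1: "linear (\<lambda>u. local_metric N h d x u w)" for w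
    using lin[of 1 _ 1 _ w] lin[of _ _ 0 0 w] by (intro linearI) simp_all
  moreover have "linear (local_metric N h d x w)" for w
    using 1[of w] unfolding comm[of _ w] .
  ultimately show "bilinear (local_metric N h d x)" by (simp add: bilinear_def)
  show "0 < local_metric N h d x u u" if "u \<noteq> 0" for u
  proof -
    have "tangent_of N q d u d \<noteq> 0" using that by (simp add: tangent_of_component[OF dq])
    then have "tangent_of N q d u \<noteq> zero_tangent" by (auto simp: zero_tangent_def)
    then show ?thesis
      unfolding lm by (rule h_q[THEN conjunct2, THEN conjunct2, rule_format, OF T])
  qed
qed

lemma killing_domain_local:
  assumes h: "riemannian_metric N h" and d: "d \<in> atlas N" and \<zeta>: "killing_field N h \<zeta>"
  shows "killing_domain (chart_img d) (local_metric N h d) (\<lambda>x. \<zeta> (chart_inv d x) d)"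
proof -
  interpret metric_domain "chart_img d" "local_metric N h d"
    by (rule metric_domain_local_metric[OF h d])
  show ?thesis
  proof
    show "smooth_on (chart_img d) (\<lambda>x. \<zeta> (chart_inv d x) d)"
      by (rule \<zeta>[unfolded killing_field_def smooth_vector_field_def, THEN conjunct1,
            THEN conjunct2, THEN bspec, OF d])
    show "lie_derivative_metric (local_metric N h d) (\<lambda>x. \<zeta> (chart_inv d x) d) x u v = 0"
      if "x \<in> chart_img d" for x u v
      by (rule \<zeta>[unfolded killing_field_def, THEN conjunct2, rule_format, OF d that])
  qed
qed

end

section \<open>Tension and bitension\<close>

text \<open>The component is taken in the very chart in which \<open>tension\<close> was computed at
  \<open>p\<close>, so the local expression is recovered unchanged.\<close>

lemma tension_component:
  assumes N: "smooth_manifold N" and "\<phi> p \<in> points N"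
  shows "tension M g N h \<phi> p (chart_at N (\<phi> p)) =
    local_tension (local_metric M g (chart_at M p)) (local_metric N h (chart_at N (\<phi> p)))
      (local_map (chart_at M p) (chart_at N (\<phi> p)) \<phi>) (chart_map (chart_at M p) p)"
proof -
  interpret smooth_manifold_charts N using N by unfold_locales
  show ?thesis by (simp add: tension_def Let_def tangent_of_component chart_at assms)
qed

lemma bitension_zero:
  fixes M :: "('a, 'm::euclidean_space) manifold" and N :: "('b, 'n::euclidean_space) manifold"
  assumes M: "smooth_manifold M" and N: "smooth_manifold N" and h: "riemannian_metric N h"
    and \<phi>: "smooth_map M N \<phi>"
    and tension: "\<forall>p\<in>points M. tension M g N h \<phi> p = \<zeta> (\<phi> p)"
    and \<zeta>: "killing_field N h \<zeta>"
    and const: "\<forall>q\<in>points N. h q (\<zeta> q) (\<zeta> q) = k"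
    and p: "p \<in> points M"
  shows "bitension M g N h \<phi> p = zero_tangent"
proof -
  interpret M: smooth_manifold_charts M using M by unfold_locales
  interpret N: smooth_manifold_charts N using N by unfold_locales
  have cont: "continuous_map (mtop M) (mtop N) \<phi>" using \<phi> by (simp add: smooth_map_def)
  have \<phi>p: "\<phi> p \<in> points N" using cont p by (auto simp: continuous_map_def)
  define c where "c = chart_at M p"
  define d where "d = chart_at N (\<phi> p)"
  have c: "c \<in> charts_at M p" "c \<in> atlas M" "p \<in> chart_dom c"
    and d: "d \<in> charts_at N (\<phi> p)" "d \<in> atlas N" "\<phi> p \<in> chart_dom d"
    using M.chart_at[OF p] N.chart_at[OF \<phi>p] by (auto simp: c_def d_def charts_at_def)
  let ?H = "local_metric N h d" and ?f = "local_map c d \<phi>" and ?Z = "\<lambda>y. \<zeta> (chart_inv d y) d"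
  let ?\<sigma> = "\<lambda>x. tension M g N h \<phi> (chart_inv c x) d"
  define U where "U = chart_map c ` {p \<in> chart_dom c. \<phi> p \<in> chart_dom d}"
  interpret killing_domain "chart_img d" ?H ?Z
    by (rule N.killing_domain_local[OF h d(2) \<zeta>])
  have fmap: "?f (chart_map c q) = chart_map d (\<phi> q)" if "q \<in> chart_dom c" for q
    using that c by (simp add: local_map_def M.chart_inv_chart_map)
  have "local_bitension (local_metric M g c) ?H ?f ?\<sigma> (chart_map c p) = 0"
  proof (rule local_bitension_zero[where U = U])
    have "openin (mtop M) {q \<in> points M. \<phi> q \<in> chart_dom d}"
      by (rule openin_continuous_map_preimage[OF cont N.chart_topology(1)[OF d(2)]])
    then have "openin (mtop M) (chart_dom c \<inter> {q \<in> points M. \<phi> q \<in> chart_dom d})"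
      using M.chart_topology(1)[OF c(2)] by blast
    moreover have "chart_dom c \<inter> {q \<in> points M. \<phi> q \<in> chart_dom d}
        = {q \<in> chart_dom c. \<phi> q \<in> chart_dom d}"
      using M.chart_topology(5)[OF c(2)] by auto
    ultimately show "open U" unfolding U_def by (intro M.open_chart_image[OF c(2)]) auto
    show "chart_map c p \<in> U" using c d by (auto simp: U_def)
    show "?f ` U \<subseteq> chart_img d" by (auto simp: U_def fmap chart_img_def)
    show "smooth_on U ?f" using \<phi> c d by (simp add: smooth_map_def U_def)
    \<comment> \<open>At points near \<open>p\<close>, \<open>tension\<close> is computed in
      whatever charts are chosen there. The hypothesis replaces it by \<open>\<zeta>\<close>, whose
      component in \<open>d\<close> is smooth, so these choices need not be compared with
      \<open>c\<close> and \<open>d\<close>.\<close>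
    show "?\<sigma> y = ?Z (?f y)" if y: "y \<in> U" for y
    proof -
      obtain q where q: "q \<in> chart_dom c" "\<phi> q \<in> chart_dom d" "y = chart_map c q"
        using y unfolding U_def by blast
      then have "q \<in> points M" using M.chart_topology(5)[OF c(2)] by auto
      then show ?thesis
        using q tension by (simp add: fmap M.chart_inv_chart_map[OF c(2)] N.chart_inv_chart_map[OF d(2)])
    qed
    \<comment> \<open>A tangent vector is rebuilt from its component in \<open>d\<close>, so the
      local metric on \<open>?Z y\<close> is the squared norm of \<open>\<zeta>\<close>.\<close>
    show "?H y (?Z y) (?Z y) = k" if y: "y \<in> chart_img d" for y
    proof -
      let ?q = "chart_inv d y"
      have dq: "d \<in> charts_at N ?q" by (rule N.charts_at_chart_inv[OF d(2) y])
      then have q: "?q \<in> points N" using N.chart_topology(5)[OF d(2)] by (auto simp: charts_at_def)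
      have "\<zeta> ?q \<in> tangent_space N ?q"
        using \<zeta> q unfolding killing_field_def smooth_vector_field_def by blast
      then show ?thesis
        using const q by (simp add: local_metric_def Let_def N.tangent_of_of_component[OF dq])
    qed
    show "local_tension (local_metric M g c) ?H ?f (chart_map c p) = ?Z (?f (chart_map c p))"
      using tension_component[where \<phi> = \<phi> and p = p, OF N \<phi>p, of M g h] tension p c d
      by (simp add: fmap N.chart_inv_chart_map flip: c_def d_def)
  qed
  then show ?thesis
    unfolding bitension_def Let_def by (simp add: N.tangent_of_zero[OF d(1)] flip: c_def d_def)
qed

text \<open>Linearity of \<open>h q\<close> is available only on the tangent space. There the zero
  vector is written as a combination with zero coefficients.\<close>

lemma metric_zero_tangent:
  assumes "riemannian_metric N h" "q \<in> points N" "zero_tangent \<in> tangent_space N q"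
  shows "h q zero_tangent zero_tangent = 0"
proof -
  note h_q = assms(1)[unfolded riemannian_metric_def, THEN conjunct1, THEN bspec, OF assms(2)]
  have "h q (\<lambda>c. 0 *\<^sub>R zero_tangent c + 0 *\<^sub>R zero_tangent c) zero_tangent =
      0 * h q zero_tangent zero_tangent + 0 * h q zero_tangent zero_tangent"
    by (rule h_q[THEN conjunct2, THEN conjunct1, rule_format, OF assms(3,3,3)])
  then show ?thesis by (simp add: zero_tangent_def)
qed

theorem proposition2p6:
  fixes M :: "('a, 'm::euclidean_space) manifold"
    and g :: "('a, 'm) metric"
    and N :: "('b, 'n::euclidean_space) manifold"
    and h :: "('b, 'n) metric"
    and \<phi> :: "'a \<Rightarrow> 'b"
    and \<zeta> :: "'b \<Rightarrow> ('b, 'n) tangent"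
    and c :: real
  assumes "riemannian_manifold M g"
    and "riemannian_manifold N h"
    and "submersion M N \<phi>"
    and "\<not> compact_space (mtop M)"
    and "smooth_vector_field N \<zeta>"
    and "\<forall>p\<in>points M. tension M g N h \<phi> p = \<zeta> (\<phi> p)"
    and "killing_field N h \<zeta>"
    and "\<forall>q\<in>points N. h q (\<zeta> q) (\<zeta> q) = c\<^sup>2"
    and "c\<^sup>2 \<noteq> 0"
  shows "proper_biharmonic M g N h \<phi>"
proof -
  have M: "smooth_manifold M" and N: "smooth_manifold N" "riemannian_metric N h"
    and \<phi>: "smooth_map M N \<phi>"
    using assms by (auto simp: riemannian_manifold_def submersion_def)
  have "\<forall>p\<in>points M. bitension M g N h \<phi> p = zero_tangent"
    using bitension_zero[OF M N \<phi> assms(6,7,8)] by blast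
  moreover have "\<not> harmonic M g N h \<phi>"
  proof
    assume harm: "harmonic M g N h \<phi>"
    \<comment> \<open>Manifolds are nonempty. At any point, vanishing tension would make
      \<open>\<zeta>\<close> zero at its image, with squared norm 0 instead of
      \<open>c\<^sup>2\<close>.\<close>
    obtain p where p: "p \<in> points M" using M unfolding smooth_manifold_def by blast
    then have q: "\<phi> p \<in> points N" using \<phi> by (auto simp: smooth_map_def continuous_map_def)
    have z: "\<zeta> (\<phi> p) = zero_tangent" using harm p assms(6) by (simp add: harmonic_def)
    then have "zero_tangent \<in> tangent_space N (\<phi> p)"
      using assms(5) q by (metis smooth_vector_field_def)
    then show False using metric_zero_tangent[OF N(2) q] assms(8,9) q z by metis
  qed
  ultimately show ?thesis using \<phi> by (simp add: proper_biharmonic_def biharmonic_def)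
qed

end
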